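(* Let $n\geq 0$. Let $S$ be a monoid and let $H$ be a maximal subgroup of $S$ contained in a completely simple minimal ideal $U$ of $S$. If $S$ is of type left-$\mathrm{FP}_n$ and $U$ has finitely many left ideals, then $H$ is of type $\mathrm{FP}_n$.
   Context: For a monoid $S$, $\mathbb{Z}S$ denotes the integral monoid ring, and $\mathbb{Z}$ is regarded as the trivial left $\mathbb{Z}S$-module via the augmentation $\epsilon_S:\mathbb{Z}S\to\mathbb{Z}$, $s\mapsto 1$ ($s\in S$). For $n\geq 0$, the monoid $S$ is of type left-$\mathrm{FP}_n$ if there is an exact sequence $A_n\to A_{n-1}\to\cdots\to A_0\to\mathbb{Z}\to 0$ of left $\mathbb{Z}S$-modules with $A_0,\ldots,A_n$ finitely generated free left $\mathbb{Z}S$-modules. For a group, left-$\mathrm{FP}_n$ and its right-hand dual are equivalent and one says "type $\mathrm{FP}_n$". A semigroup is simple if it has no proper two-sided ideals, and completely simple if it is simple and has minimal left and minimal right ideals. A minimal ideal means a minimal two-sided ideal. For an idempotent $e$ of $S$, the maximal subgroup of $S$ containing $e$ is the group of units of the monoid $eSe$; it is the largest subgroup of $S$ with identity $e$. The left ideals of $U$ are those of $U$ regarded as a semigroup. *)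

theory Defs
  imports "HOL-Algebra.Algebra" "HOL-Library.Poly_Mapping"
begin

section \<open>Left modules over arbitrary rings\<close>

text \<open>The locale \<open>module\<close> of HOL-Algebra is restricted to commutative rings.  The monoid ring of a
  noncommutative monoid is not commutative, so the same axioms are stated here over any ring.\<close>

locale left_module = R?: ring R + M?: abelian_group M
  for R :: "('r, 'c) ring_scheme" (structure) and M :: "('r, 'm, 'd) module_scheme" (structure) +
  assumes smult_closed:
      "\<lbrakk>a \<in> carrier R; x \<in> carrier M\<rbrakk> \<Longrightarrow> a \<odot>\<^bsub>M\<^esub> x \<in> carrier M"
    and smult_l_distr:
      "\<lbrakk>a \<in> carrier R; b \<in> carrier R; x \<in> carrier M\<rbrakk>
        \<Longrightarrow> (a \<oplus> b) \<odot>\<^bsub>M\<^esub> x = a \<odot>\<^bsub>M\<^esub> x \<oplus>\<^bsub>M\<^esub> b \<odot>\<^bsub>M\<^esub> x"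
    and smult_r_distr:
      "\<lbrakk>a \<in> carrier R; x \<in> carrier M; y \<in> carrier M\<rbrakk>
        \<Longrightarrow> a \<odot>\<^bsub>M\<^esub> (x \<oplus>\<^bsub>M\<^esub> y) = a \<odot>\<^bsub>M\<^esub> x \<oplus>\<^bsub>M\<^esub> a \<odot>\<^bsub>M\<^esub> y"
    and smult_assoc1:
      "\<lbrakk>a \<in> carrier R; b \<in> carrier R; x \<in> carrier M\<rbrakk>
        \<Longrightarrow> (a \<otimes> b) \<odot>\<^bsub>M\<^esub> x = a \<odot>\<^bsub>M\<^esub> (b \<odot>\<^bsub>M\<^esub> x)"
    and smult_one: "x \<in> carrier M \<Longrightarrow> \<one> \<odot>\<^bsub>M\<^esub> x = x"

definition left_module_hom ::
    "('r, 'c) ring_scheme \<Rightarrow> ('r, 'm, 'd) module_scheme \<Rightarrow> ('r, 'k, 'e) module_scheme \<Rightarrow> ('m \<Rightarrow> 'k) \<Rightarrow> bool"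
  where "left_module_hom R M N f \<longleftrightarrow>
    f \<in> hom (add_monoid M) (add_monoid N) \<and>
    (\<forall>a\<in>carrier R. \<forall>x\<in>carrier M. f (a \<odot>\<^bsub>M\<^esub> x) = a \<odot>\<^bsub>N\<^esub> f x)"

definition is_finite_basis :: "('r, 'c) ring_scheme \<Rightarrow> ('r, 'm, 'd) module_scheme \<Rightarrow> 'm set \<Rightarrow> bool"
  where "is_finite_basis R M B \<longleftrightarrow> finite B \<and> B \<subseteq> carrier M \<and>
    (\<forall>x\<in>carrier M. \<exists>!c. c \<in> B \<rightarrow>\<^sub>E carrier R \<and> x = (\<Oplus>\<^bsub>M\<^esub>b\<in>B. c b \<odot>\<^bsub>M\<^esub> b))"

definition fg_free_left_module :: "('r, 'c) ring_scheme \<Rightarrow> ('r, 'm, 'd) module_scheme \<Rightarrow> bool"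
  where "fg_free_left_module R M \<longleftrightarrow> left_module R M \<and> (\<exists>B. is_finite_basis R M B)"

text \<open>Exactness of \<open>A n \<rightarrow> A (n - 1) \<rightarrow> \<dots> \<rightarrow> A 0 \<rightarrow> N \<rightarrow> 0\<close>, with maps \<open>d i : A i \<rightarrow> A (i - 1)\<close> for
  \<open>1 \<le> i \<le> n\<close> and \<open>p : A 0 \<rightarrow> N\<close>.  No condition is imposed at \<open>A n\<close>.\<close>

definition partial_free_resolution ::
    "('r, 'c) ring_scheme \<Rightarrow> ('r, 'k, 'd) module_scheme \<Rightarrow> nat \<Rightarrow>
     (nat \<Rightarrow> ('r, 'm, 'e) module_scheme) \<Rightarrow> (nat \<Rightarrow> 'm \<Rightarrow> 'm) \<Rightarrow> ('m \<Rightarrow> 'k) \<Rightarrow> bool"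
  where "partial_free_resolution R N n A d p \<longleftrightarrow>
    (\<forall>i\<le>n. fg_free_left_module R (A i)) \<and>
    (\<forall>i\<in>{1..n}. left_module_hom R (A i) (A (i - 1)) (d i)) \<and>
    left_module_hom R (A 0) N p \<and>
    p ` carrier (A 0) = carrier N \<and>
    (1 \<le> n \<longrightarrow> d 1 ` carrier (A 1) = a_kernel (A 0) N p) \<and>
    (\<forall>i\<in>{1..<n}. d (Suc i) ` carrier (A (Suc i)) = a_kernel (A i) (A (i - 1)) (d i))"


section \<open>Integral monoid rings and the finiteness property left-FP\<close>

definition monoid_ring :: "('a, 'b) monoid_scheme \<Rightarrow> ('a \<Rightarrow>\<^sub>0 int) ring"
  where "monoid_ring S =
    \<lparr>carrier = {f. Poly_Mapping.keys f \<subseteq> carrier S},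
     monoid.mult = (\<lambda>f g. \<Sum>a\<in>Poly_Mapping.keys f. \<Sum>b\<in>Poly_Mapping.keys g.
       Poly_Mapping.single (a \<otimes>\<^bsub>S\<^esub> b) (Poly_Mapping.lookup f a * Poly_Mapping.lookup g b)),
     one = Poly_Mapping.single \<one>\<^bsub>S\<^esub> 1,
     ring.zero = 0,
     add = (+)\<rparr>"

definition augmentation :: "('a \<Rightarrow>\<^sub>0 int) \<Rightarrow> int"
  where "augmentation f = (\<Sum>a\<in>Poly_Mapping.keys f. Poly_Mapping.lookup f a)"

text \<open>The fields \<open>mult\<close> and \<open>one\<close> play no role in a module.\<close>

definition trivial_module :: "('a \<Rightarrow>\<^sub>0 int, int) module"
  where "trivial_module =
    \<lparr>carrier = UNIV, monoid.mult = (*), one = 1, ring.zero = 0, add = (+),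
     smult = (\<lambda>f m. augmentation f * m)\<rparr>"

text \<open>HOL cannot quantify over types inside a definition, so the free modules are taken with carriers
  inside the type \<open>nat \<Rightarrow> ('a \<Rightarrow>\<^sub>0 int)\<close>, which contains a copy of every finite power of the monoid
  ring.  Lemma \<open>left_FP_I\<close> below shows that this is no restriction.\<close>

definition left_FP :: "nat \<Rightarrow> ('a, 'b) monoid_scheme \<Rightarrow> bool"
  where "left_FP n S \<longleftrightarrow>
    (\<exists>(A :: nat \<Rightarrow> ('a \<Rightarrow>\<^sub>0 int, nat \<Rightarrow> ('a \<Rightarrow>\<^sub>0 int)) module) d p.
      partial_free_resolution (monoid_ring S) trivial_module n A d p)"

text \<open>For groups the left and right versions agree (via inversion), so the side is not mentioned.\<close>

abbreviation (input) type_FP :: "nat \<Rightarrow> ('a, 'b) monoid_scheme \<Rightarrow> bool"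
  where "type_FP n G \<equiv> left_FP n G"


section \<open>Ideals and maximal subgroups\<close>

text \<open>A semigroup is represented by the fields \<open>carrier\<close> and \<open>mult\<close> of a monoid record; the
  definitions of this section up to \<open>completely_simple\<close> ignore the field \<open>one\<close>.  A subset \<open>U\<close> closed
  under multiplication is regarded as a semigroup through \<open>S\<lparr>carrier := U\<rparr>\<close>.  Ideals are nonempty.\<close>

definition left_ideal :: "('a, 'b) monoid_scheme \<Rightarrow> 'a set \<Rightarrow> bool"
  where "left_ideal T L \<longleftrightarrow> L \<subseteq> carrier T \<and> L \<noteq> {} \<and>
    (\<forall>s\<in>carrier T. \<forall>x\<in>L. s \<otimes>\<^bsub>T\<^esub> x \<in> L)"

definition right_ideal :: "('a, 'b) monoid_scheme \<Rightarrow> 'a set \<Rightarrow> bool"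
  where "right_ideal T L \<longleftrightarrow> L \<subseteq> carrier T \<and> L \<noteq> {} \<and>
    (\<forall>s\<in>carrier T. \<forall>x\<in>L. x \<otimes>\<^bsub>T\<^esub> s \<in> L)"

definition two_sided_ideal :: "('a, 'b) monoid_scheme \<Rightarrow> 'a set \<Rightarrow> bool"
  where "two_sided_ideal T I \<longleftrightarrow> left_ideal T I \<and> right_ideal T I"

definition minimal_set :: "('a set \<Rightarrow> bool) \<Rightarrow> 'a set \<Rightarrow> bool"
  where "minimal_set P I \<longleftrightarrow> P I \<and> (\<forall>J. P J \<and> J \<subseteq> I \<longrightarrow> J = I)"

abbreviation minimal_ideal :: "('a, 'b) monoid_scheme \<Rightarrow> 'a set \<Rightarrow> bool"
  where "minimal_ideal T \<equiv> minimal_set (two_sided_ideal T)"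

definition simple_semigroup :: "('a, 'b) monoid_scheme \<Rightarrow> bool"
  where "simple_semigroup T \<longleftrightarrow> (\<forall>I. two_sided_ideal T I \<longrightarrow> I = carrier T)"

definition completely_simple :: "('a, 'b) monoid_scheme \<Rightarrow> bool"
  where "completely_simple T \<longleftrightarrow> simple_semigroup T \<and>
    (\<exists>L. minimal_set (left_ideal T) L) \<and> (\<exists>R. minimal_set (right_ideal T) R)"

definition local_monoid :: "('a, 'b) monoid_scheme \<Rightarrow> 'a \<Rightarrow> ('a, 'b) monoid_scheme"
  where "local_monoid S e = S\<lparr>carrier := {e \<otimes>\<^bsub>S\<^esub> s \<otimes>\<^bsub>S\<^esub> e | s. s \<in> carrier S}, one := e\<rparr>"

definition maximal_subgroup :: "('a, 'b) monoid_scheme \<Rightarrow> 'a monoid \<Rightarrow> bool"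
  where "maximal_subgroup S H \<longleftrightarrow>
    (\<exists>e\<in>carrier S. e \<otimes>\<^bsub>S\<^esub> e = e \<and> H = units_of (local_monoid S e))"


section \<open>Basic properties\<close>

lemma mult_monoid_ring_eq:
  assumes "finite F" "finite G" "Poly_Mapping.keys f \<subseteq> F" "Poly_Mapping.keys g \<subseteq> G"
  shows "f \<otimes>\<^bsub>monoid_ring S\<^esub> g =
    (\<Sum>a\<in>F. \<Sum>b\<in>G. Poly_Mapping.single (a \<otimes>\<^bsub>S\<^esub> b) (Poly_Mapping.lookup f a * Poly_Mapping.lookup g b))"
proof -
  have "(\<Sum>b\<in>Poly_Mapping.keys g. Poly_Mapping.single (a \<otimes>\<^bsub>S\<^esub> b) (Poly_Mapping.lookup f a * Poly_Mapping.lookup g b)) =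
      (\<Sum>b\<in>G. Poly_Mapping.single (a \<otimes>\<^bsub>S\<^esub> b) (Poly_Mapping.lookup f a * Poly_Mapping.lookup g b))" for a
    using assms by (intro sum.mono_neutral_left) (auto simp: in_keys_iff)
  moreover have "(\<Sum>a\<in>Poly_Mapping.keys f. \<Sum>b\<in>G. Poly_Mapping.single (a \<otimes>\<^bsub>S\<^esub> b) (Poly_Mapping.lookup f a * Poly_Mapping.lookup g b)) =
      (\<Sum>a\<in>F. \<Sum>b\<in>G. Poly_Mapping.single (a \<otimes>\<^bsub>S\<^esub> b) (Poly_Mapping.lookup f a * Poly_Mapping.lookup g b))"
    using assms by (intro sum.mono_neutral_left) (auto simp: in_keys_iff)
  ultimately show ?thesis by (simp add: monoid_ring_def)
qed

lemma monoid_ring_distrib_right: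
  "(f + g) \<otimes>\<^bsub>monoid_ring S\<^esub> h = f \<otimes>\<^bsub>monoid_ring S\<^esub> h + g \<otimes>\<^bsub>monoid_ring S\<^esub> h"
proof -
  have K: "Poly_Mapping.keys (f + g) \<subseteq> Poly_Mapping.keys f \<union> Poly_Mapping.keys g" by (rule keys_add)
  show ?thesis
    by (simp add: mult_monoid_ring_eq[of "Poly_Mapping.keys f \<union> Poly_Mapping.keys g" "Poly_Mapping.keys h"] K lookup_add
        algebra_simps single_add sum.distrib)
qed

lemma monoid_ring_distrib_left:
  "h \<otimes>\<^bsub>monoid_ring S\<^esub> (f + g) = h \<otimes>\<^bsub>monoid_ring S\<^esub> f + h \<otimes>\<^bsub>monoid_ring S\<^esub> g"
proof -
  have K: "Poly_Mapping.keys (f + g) \<subseteq> Poly_Mapping.keys f \<union> Poly_Mapping.keys g" by (rule keys_add)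
  show ?thesis
    by (simp add: mult_monoid_ring_eq[of "Poly_Mapping.keys h" "Poly_Mapping.keys f \<union> Poly_Mapping.keys g"] K lookup_add
        algebra_simps single_add sum.distrib)
qed

lemma monoid_ring_mult_zero [simp]:
  "0 \<otimes>\<^bsub>monoid_ring S\<^esub> f = 0" "f \<otimes>\<^bsub>monoid_ring S\<^esub> 0 = 0"
  by (simp_all add: monoid_ring_def)

lemma monoid_ring_sum_left:
  "(\<Sum>i\<in>I. f i) \<otimes>\<^bsub>monoid_ring S\<^esub> g = (\<Sum>i\<in>I. f i \<otimes>\<^bsub>monoid_ring S\<^esub> g)"
  by (induction I rule: infinite_finite_induct) (simp_all add: monoid_ring_distrib_right)

lemma monoid_ring_sum_right:
  "g \<otimes>\<^bsub>monoid_ring S\<^esub> (\<Sum>i\<in>I. f i) = (\<Sum>i\<in>I. g \<otimes>\<^bsub>monoid_ring S\<^esub> f i)"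
  by (induction I rule: infinite_finite_induct) (simp_all add: monoid_ring_distrib_left)

lemma monoid_ring_mult_single:
  "Poly_Mapping.single a m \<otimes>\<^bsub>monoid_ring S\<^esub> Poly_Mapping.single b k =
    Poly_Mapping.single (a \<otimes>\<^bsub>S\<^esub> b) (m * k)"
  by (simp add: mult_monoid_ring_eq[of "{a}" "{b}"])

lemma sum_single_keys: "(\<Sum>a\<in>Poly_Mapping.keys f. Poly_Mapping.single a (Poly_Mapping.lookup f a)) = f"
  by (rule poly_mapping_eqI)
    (auto simp: lookup_sum lookup_single when_def in_keys_iff)

lemma keys_sum_subset:
  assumes "\<And>i. i \<in> I \<Longrightarrow> Poly_Mapping.keys (f i) \<subseteq> C"
  shows "Poly_Mapping.keys (\<Sum>i\<in>I. f i) \<subseteq> C"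
  using assms
proof (induction I rule: infinite_finite_induct)
  case (insert x F)
  then show ?case using keys_add[of "f x" "sum f F"] by auto
qed auto

lemma monoid_ring_mult_assoc:
  assumes "monoid S" "Poly_Mapping.keys f \<subseteq> carrier S" "Poly_Mapping.keys g \<subseteq> carrier S" "Poly_Mapping.keys h \<subseteq> carrier S"
  shows "f \<otimes>\<^bsub>monoid_ring S\<^esub> g \<otimes>\<^bsub>monoid_ring S\<^esub> h = f \<otimes>\<^bsub>monoid_ring S\<^esub> (g \<otimes>\<^bsub>monoid_ring S\<^esub> h)"
proof -
  let ?s = "\<lambda>f a. Poly_Mapping.single a (Poly_Mapping.lookup f a)"
  let ?K = "Poly_Mapping.keys" and ?R = "monoid_ring S"
  let ?F = "\<Sum>a\<in>?K f. ?s f a" and ?G = "\<Sum>b\<in>?K g. ?s g b" and ?H = "\<Sum>c\<in>?K h. ?s h c"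
  have *: "?s f a \<otimes>\<^bsub>monoid_ring S\<^esub> ?s g b \<otimes>\<^bsub>monoid_ring S\<^esub> ?s h c =
      ?s f a \<otimes>\<^bsub>monoid_ring S\<^esub> (?s g b \<otimes>\<^bsub>monoid_ring S\<^esub> ?s h c)"
    if "a \<in> Poly_Mapping.keys f" "b \<in> Poly_Mapping.keys g" "c \<in> Poly_Mapping.keys h" for a b c
    using that assms by (auto simp: monoid_ring_mult_single mult.assoc monoid.m_assoc subset_iff)
  have "?F \<otimes>\<^bsub>?R\<^esub> ?G \<otimes>\<^bsub>?R\<^esub> ?H = (\<Sum>a\<in>?K f. \<Sum>b\<in>?K g. ?s f a \<otimes>\<^bsub>?R\<^esub> ?s g b) \<otimes>\<^bsub>?R\<^esub> ?H"
    unfolding monoid_ring_sum_left[where I = "?K f"] unfolding monoid_ring_sum_right[where I = "?K g"] ..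
  also have "\<dots> = (\<Sum>a\<in>?K f. \<Sum>b\<in>?K g. \<Sum>c\<in>?K h. ?s f a \<otimes>\<^bsub>?R\<^esub> ?s g b \<otimes>\<^bsub>?R\<^esub> ?s h c)"
    unfolding monoid_ring_sum_left unfolding monoid_ring_sum_right ..
  also have "\<dots> = (\<Sum>a\<in>?K f. \<Sum>b\<in>?K g. \<Sum>c\<in>?K h. ?s f a \<otimes>\<^bsub>?R\<^esub> (?s g b \<otimes>\<^bsub>?R\<^esub> ?s h c))"
    by (intro sum.cong refl *)
  also have "\<dots> = ?F \<otimes>\<^bsub>?R\<^esub> (?G \<otimes>\<^bsub>?R\<^esub> ?H)"
    unfolding monoid_ring_sum_left unfolding monoid_ring_sum_right ..
  finally have "?F \<otimes>\<^bsub>?R\<^esub> ?G \<otimes>\<^bsub>?R\<^esub> ?H = ?F \<otimes>\<^bsub>?R\<^esub> (?G \<otimes>\<^bsub>?R\<^esub> ?H)" .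
  then show ?thesis by (simp only: sum_single_keys)
qed

lemma ring_monoid_ring:
  assumes "monoid S"
  shows "ring (monoid_ring S)"
proof -
  interpret S: monoid S by fact
  let ?R = "monoid_ring S"
  have closed: "f \<otimes>\<^bsub>?R\<^esub> g \<in> carrier ?R" if "f \<in> carrier ?R" "g \<in> carrier ?R" for f g
  proof -
    have "Poly_Mapping.keys (Poly_Mapping.single (a \<otimes>\<^bsub>S\<^esub> b) (Poly_Mapping.lookup f a * Poly_Mapping.lookup g b)) \<subseteq> carrier S"
      if "a \<in> Poly_Mapping.keys f" "b \<in> Poly_Mapping.keys g" for a b
      using that \<open>f \<in> carrier ?R\<close> \<open>g \<in> carrier ?R\<close> by (auto simp: monoid_ring_def)
    then show ?thesis
      unfolding monoid_ring_def by (simp add: keys_sum_subset)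
  qed
  have onel: "\<one>\<^bsub>?R\<^esub> \<otimes>\<^bsub>?R\<^esub> f = f" if "f \<in> carrier ?R" for f
  proof -
    have "Poly_Mapping.single \<one>\<^bsub>S\<^esub> 1 \<otimes>\<^bsub>?R\<^esub> (\<Sum>a\<in>Poly_Mapping.keys f. Poly_Mapping.single a (Poly_Mapping.lookup f a)) =
        (\<Sum>a\<in>Poly_Mapping.keys f. Poly_Mapping.single a (Poly_Mapping.lookup f a))"
      unfolding monoid_ring_sum_right monoid_ring_mult_single
      using that by (intro sum.cong) (auto simp: monoid_ring_def)
    then show ?thesis by (simp only: sum_single_keys) (simp add: monoid_ring_def)
  qed
  have oner: "f \<otimes>\<^bsub>?R\<^esub> \<one>\<^bsub>?R\<^esub> = f" if "f \<in> carrier ?R" for f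
  proof -
    have "(\<Sum>a\<in>Poly_Mapping.keys f. Poly_Mapping.single a (Poly_Mapping.lookup f a)) \<otimes>\<^bsub>?R\<^esub> Poly_Mapping.single \<one>\<^bsub>S\<^esub> 1 =
        (\<Sum>a\<in>Poly_Mapping.keys f. Poly_Mapping.single a (Poly_Mapping.lookup f a))"
      unfolding monoid_ring_sum_left monoid_ring_mult_single
      using that by (intro sum.cong) (auto simp: monoid_ring_def)
    then show ?thesis by (simp only: sum_single_keys) (simp add: monoid_ring_def)
  qed
  have add: "add ?R = (+)" and zero: "\<zero>\<^bsub>?R\<^esub> = 0" and car: "carrier ?R = {f. Poly_Mapping.keys f \<subseteq> carrier S}"
    by (simp_all add: monoid_ring_def)
  show ?thesis
  proof (rule ringI)
    show "abelian_group ?R"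
    proof (rule abelian_groupI)
      fix f assume "f \<in> carrier ?R"
      then show "\<exists>g\<in>carrier ?R. g \<oplus>\<^bsub>?R\<^esub> f = \<zero>\<^bsub>?R\<^esub>"
        by (intro bexI[of _ "- f"]) (auto simp: add zero car)
    next
      fix f g assume "f \<in> carrier ?R" "g \<in> carrier ?R"
      then show "f \<oplus>\<^bsub>?R\<^esub> g \<in> carrier ?R"
        using keys_add[of f g] by (auto simp: add car)
    qed (auto simp: add zero car algebra_simps)
    show "monoid ?R"
      by (rule monoidI)
        (use closed onel oner monoid_ring_mult_assoc[OF assms] in \<open>auto simp: car\<close>,
         simp add: monoid_ring_def)
  qed (simp_all add: add monoid_ring_distrib_left monoid_ring_distrib_right)
qed

lemma augmentation_eq:
  "finite F \<Longrightarrow> Poly_Mapping.keys f \<subseteq> F \<Longrightarrow> augmentation f = (\<Sum>a\<in>F. Poly_Mapping.lookup f a)"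
  unfolding augmentation_def by (rule sum.mono_neutral_left) (auto simp: in_keys_iff)

lemma augmentation_add: "augmentation (f + g) = augmentation f + augmentation g"
  using keys_add[of f g]
  by (simp add: augmentation_eq[of "Poly_Mapping.keys f \<union> Poly_Mapping.keys g"] lookup_add sum.distrib)

lemma augmentation_zero [simp]: "augmentation 0 = 0"
  by (simp add: augmentation_def)

lemma augmentation_single [simp]: "augmentation (Poly_Mapping.single a m) = m"
  by (simp add: augmentation_eq[of "{a}"])

lemma augmentation_sum: "augmentation (\<Sum>i\<in>I. f i) = (\<Sum>i\<in>I. augmentation (f i))"
  by (induction I rule: infinite_finite_induct) (simp_all add: augmentation_add)

lemma augmentation_mult:
  "augmentation (f \<otimes>\<^bsub>monoid_ring S\<^esub> g) = augmentation f * augmentation g"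
proof -
  have "augmentation (f \<otimes>\<^bsub>monoid_ring S\<^esub> g) = (\<Sum>a\<in>Poly_Mapping.keys f. \<Sum>b\<in>Poly_Mapping.keys g. Poly_Mapping.lookup f a * Poly_Mapping.lookup g b)"
    by (simp add: monoid_ring_def augmentation_sum)
  then show ?thesis by (simp add: augmentation_def sum_product)
qed

lemma left_module_trivial_module:
  assumes "monoid S"
  shows "left_module (monoid_ring S) trivial_module"
proof -
  have "abelian_group (trivial_module :: ('a \<Rightarrow>\<^sub>0 int, int) module)"
    by (rule abelian_groupI)
      (auto simp: trivial_module_def intro: exI[of _ "- x" for x])
  moreover have "left_module_axioms (monoid_ring S) trivial_module"
    by unfold_locales
      (auto simp: trivial_module_def augmentation_mult algebra_simps,
       simp_all add: monoid_ring_def augmentation_add algebra_simps)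
  ultimately show ?thesis
    by (intro left_module.intro ring_monoid_ring assms)
qed


subsection \<open>Independence of \<open>left_FP\<close> from the type of the modules\<close>

definition transport_module :: "('m \<Rightarrow> 'k) \<Rightarrow> ('r, 'm, 'd) module_scheme \<Rightarrow> ('r, 'k) module"
  where "transport_module \<phi> M =
    \<lparr>carrier = \<phi> ` carrier M, monoid.mult = undefined, one = undefined, ring.zero = \<phi> \<zero>\<^bsub>M\<^esub>,
     add = (\<lambda>x y. \<phi> (inv_into (carrier M) \<phi> x \<oplus>\<^bsub>M\<^esub> inv_into (carrier M) \<phi> y)),
     smult = (\<lambda>a x. \<phi> (a \<odot>\<^bsub>M\<^esub> inv_into (carrier M) \<phi> x))\<rparr>"

lemma transport_module_simps:
  "carrier (transport_module \<phi> M) = \<phi> ` carrier M"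
  "\<zero>\<^bsub>transport_module \<phi> M\<^esub> = \<phi> \<zero>\<^bsub>M\<^esub>"
  by (simp_all add: transport_module_def)

lemma transport_module_ops:
  assumes "inj_on \<phi> (carrier M)"
  shows "x \<in> carrier M \<Longrightarrow> y \<in> carrier M \<Longrightarrow> \<phi> x \<oplus>\<^bsub>transport_module \<phi> M\<^esub> \<phi> y = \<phi> (x \<oplus>\<^bsub>M\<^esub> y)"
    and "x \<in> carrier M \<Longrightarrow> a \<odot>\<^bsub>transport_module \<phi> M\<^esub> \<phi> x = \<phi> (a \<odot>\<^bsub>M\<^esub> x)"
  using assms by (simp_all add: transport_module_def)

lemma left_module_transport:
  assumes "left_module R M" "inj_on \<phi> (carrier M)"
  shows "left_module R (transport_module \<phi> M)"
proof -
  interpret left_module R M by fact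
  note ops = transport_module_simps transport_module_ops[OF assms(2)]
  have "abelian_group (transport_module \<phi> M)"
  proof (rule abelian_groupI)
    fix x assume "x \<in> carrier (transport_module \<phi> M)"
    then obtain x' where x': "x = \<phi> x'" "x' \<in> carrier M" by (auto simp: ops)
    show "\<exists>y\<in>carrier (transport_module \<phi> M). y \<oplus>\<^bsub>transport_module \<phi> M\<^esub> x = \<zero>\<^bsub>transport_module \<phi> M\<^esub>"
      by (rule bexI[of _ "\<phi> (\<ominus>\<^bsub>M\<^esub> x')"]) (use x' in \<open>auto simp: ops M.l_neg\<close>)
  qed (auto simp: ops M.a_ac)
  moreover have "left_module_axioms R (transport_module \<phi> M)"
    by unfold_locales
      (auto simp: ops smult_closed smult_l_distr smult_r_distr smult_assoc1 smult_one)
  ultimately show ?thesis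
    by (intro left_module.intro R.ring_axioms)
qed

lemma finsum_transport:
  assumes "left_module R M" "inj_on \<phi> (carrier M)" "finite B" "f \<in> B \<rightarrow> carrier M"
  shows "(\<Oplus>\<^bsub>transport_module \<phi> M\<^esub>b\<in>B. \<phi> (f b)) = \<phi> (\<Oplus>\<^bsub>M\<^esub>b\<in>B. f b)"
  using assms(3,4)
proof (induction B)
  interpret left_module R M by fact
  interpret T: left_module R "transport_module \<phi> M" by (rule left_module_transport) fact+
  case empty
  then show ?case by (simp add: transport_module_simps)
next
  interpret left_module R M by fact
  interpret T: left_module R "transport_module \<phi> M" by (rule left_module_transport) fact+
  case (insert b B)
  then have "f b \<in> carrier M" "f \<in> B \<rightarrow> carrier M" by auto
  moreover from this have "(\<lambda>b. \<phi> (f b)) \<in> B \<rightarrow> carrier (transport_module \<phi> M)"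
    by (auto simp: transport_module_simps)
  ultimately show ?case
    using insert by (simp add: transport_module_simps transport_module_ops[OF assms(2)])
qed

lemma is_finite_basis_transport:
  assumes "left_module R M" "inj_on \<phi> (carrier M)" "is_finite_basis R M B"
  shows "is_finite_basis R (transport_module \<phi> M) (\<phi> ` B)"
proof -
  interpret left_module R M by fact
  interpret T: left_module R "transport_module \<phi> M" by (rule left_module_transport) fact+
  let ?T = "transport_module \<phi> M"
  note simps = transport_module_simps transport_module_ops[OF assms(2)]
  have B: "finite B" "B \<subseteq> carrier M" using assms(3) by (auto simp: is_finite_basis_def)
  have inj: "inj_on \<phi> B" using assms(2) B(2) by (rule inj_on_subset)
  have sum: "(\<Oplus>\<^bsub>?T\<^esub>b\<in>\<phi> ` B. c b \<odot>\<^bsub>?T\<^esub> b) = \<phi> (\<Oplus>\<^bsub>M\<^esub>b\<in>B. c (\<phi> b) \<odot>\<^bsub>M\<^esub> b)"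
    if c: "c \<in> \<phi> ` B \<rightarrow> carrier R" for c
  proof -
    have cl: "(\<lambda>b. c (\<phi> b) \<odot>\<^bsub>M\<^esub> b) \<in> B \<rightarrow> carrier M"
      using c B by (auto intro!: smult_closed)
    have "(\<Oplus>\<^bsub>?T\<^esub>b\<in>\<phi> ` B. c b \<odot>\<^bsub>?T\<^esub> b) = (\<Oplus>\<^bsub>?T\<^esub>b\<in>B. c (\<phi> b) \<odot>\<^bsub>?T\<^esub> \<phi> b)"
      using c B inj by (intro T.M.finsum_reindex) (auto simp: simps subset_iff intro!: imageI smult_closed)
    also have "\<dots> = (\<Oplus>\<^bsub>?T\<^esub>b\<in>B. \<phi> (c (\<phi> b) \<odot>\<^bsub>M\<^esub> b))"
      using c B by (intro T.M.finsum_cong') (auto simp: simps intro!: smult_closed)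
    also have "\<dots> = \<phi> (\<Oplus>\<^bsub>M\<^esub>b\<in>B. c (\<phi> b) \<odot>\<^bsub>M\<^esub> b)"
      by (rule finsum_transport[OF assms(1,2) B(1) cl])
    finally show ?thesis .
  qed
  have "\<exists>!c. c \<in> \<phi> ` B \<rightarrow>\<^sub>E carrier R \<and> \<phi> x = (\<Oplus>\<^bsub>?T\<^esub>b\<in>\<phi> ` B. c b \<odot>\<^bsub>?T\<^esub> b)"
    if x: "x \<in> carrier M" for x
  proof -
    have ex1: "\<exists>!c. c \<in> B \<rightarrow>\<^sub>E carrier R \<and> x = (\<Oplus>\<^bsub>M\<^esub>b\<in>B. c b \<odot>\<^bsub>M\<^esub> b)"
      using assms(3) x by (simp add: is_finite_basis_def)
    then obtain c where c: "c \<in> B \<rightarrow>\<^sub>E carrier R" "x = (\<Oplus>\<^bsub>M\<^esub>b\<in>B. c b \<odot>\<^bsub>M\<^esub> b)"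
      by blast
    have uniq: "c' = c" if "c' \<in> B \<rightarrow>\<^sub>E carrier R" "x = (\<Oplus>\<^bsub>M\<^esub>b\<in>B. c' b \<odot>\<^bsub>M\<^esub> b)" for c'
      using the1_equality[OF ex1, of c'] the1_equality[OF ex1, of c] that c by simp
    define e where "e = restrict (c \<circ> inv_into B \<phi>) (\<phi> ` B)"
    have e: "e \<in> \<phi> ` B \<rightarrow>\<^sub>E carrier R" using c(1) inj by (auto simp: e_def PiE_iff)
    have eB: "e (\<phi> b) = c b" if "b \<in> B" for b using that inj by (simp add: e_def)
    have "(\<Oplus>\<^bsub>M\<^esub>b\<in>B. e (\<phi> b) \<odot>\<^bsub>M\<^esub> b) = (\<Oplus>\<^bsub>M\<^esub>b\<in>B. c b \<odot>\<^bsub>M\<^esub> b)"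
      using c(1) B by (intro M.finsum_cong') (auto simp: eB intro!: smult_closed)
    then have ex: "\<phi> x = (\<Oplus>\<^bsub>?T\<^esub>b\<in>\<phi> ` B. e b \<odot>\<^bsub>?T\<^esub> b)"
      using e c(2) by (subst sum) auto
    show ?thesis
    proof (rule ex1I[of _ e])
      show "e \<in> \<phi> ` B \<rightarrow>\<^sub>E carrier R \<and> \<phi> x = (\<Oplus>\<^bsub>?T\<^esub>b\<in>\<phi> ` B. e b \<odot>\<^bsub>?T\<^esub> b)"
        using e ex by blast
    next
      fix e' assume a: "e' \<in> \<phi> ` B \<rightarrow>\<^sub>E carrier R \<and> \<phi> x = (\<Oplus>\<^bsub>?T\<^esub>b\<in>\<phi> ` B. e' b \<odot>\<^bsub>?T\<^esub> b)"
      define c' where "c' = restrict (e' \<circ> \<phi>) B"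
      have c': "c' \<in> B \<rightarrow>\<^sub>E carrier R" using a by (auto simp: c'_def PiE_iff)
      have cl: "(\<lambda>b. e' (\<phi> b) \<odot>\<^bsub>M\<^esub> b) \<in> B \<rightarrow> carrier M"
        using a B by (auto intro!: smult_closed)
      have "(\<Oplus>\<^bsub>?T\<^esub>b\<in>\<phi> ` B. e' b \<odot>\<^bsub>?T\<^esub> b) = \<phi> (\<Oplus>\<^bsub>M\<^esub>b\<in>B. e' (\<phi> b) \<odot>\<^bsub>M\<^esub> b)"
        using a by (intro sum) auto
      with a have "\<phi> x = \<phi> (\<Oplus>\<^bsub>M\<^esub>b\<in>B. e' (\<phi> b) \<odot>\<^bsub>M\<^esub> b)" by simp
      then have "x = (\<Oplus>\<^bsub>M\<^esub>b\<in>B. e' (\<phi> b) \<odot>\<^bsub>M\<^esub> b)"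
        using assms(2) x M.finsum_closed[OF cl] by (auto dest: inj_onD)
      also have "\<dots> = (\<Oplus>\<^bsub>M\<^esub>b\<in>B. c' b \<odot>\<^bsub>M\<^esub> b)"
        using cl by (intro M.finsum_cong') (auto simp: c'_def)
      finally have "c' = c" using c' uniq by blast
      then have "e' (\<phi> b) = c b" if "b \<in> B" for b
        using that by (metis c'_def comp_apply restrict_apply')
      then have "e' y = e y" if "y \<in> \<phi> ` B" for y
        using that eB by auto
      then show "e' = e" using a e by (blast intro: PiE_ext)
    qed
  qed
  then show ?thesis using B by (auto simp: is_finite_basis_def transport_module_simps)
qed

lemma fg_free_left_module_embeds:
  fixes M :: "('r, 'm, 'd) module_scheme"
  assumes "fg_free_left_module R M"
  shows "\<exists>\<phi> :: 'm \<Rightarrow> nat \<Rightarrow> 'r. inj_on \<phi> (carrier M)"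
proof -
  from assms obtain B where B: "is_finite_basis R M B" by (auto simp: fg_free_left_module_def)
  then have "\<forall>x\<in>carrier M. \<exists>c. c \<in> B \<rightarrow>\<^sub>E carrier R \<and> x = (\<Oplus>\<^bsub>M\<^esub>b\<in>B. c b \<odot>\<^bsub>M\<^esub> b)"
    unfolding is_finite_basis_def by blast
  then obtain c where c: "\<And>x. x \<in> carrier M \<Longrightarrow> c x \<in> B \<rightarrow>\<^sub>E carrier R"
      "\<And>x. x \<in> carrier M \<Longrightarrow> x = (\<Oplus>\<^bsub>M\<^esub>b\<in>B. c x b \<odot>\<^bsub>M\<^esub> b)"
    by metis
  have "finite B" using B by (simp add: is_finite_basis_def)
  then obtain h :: "nat \<Rightarrow> 'm" and n where h: "B = h ` {i. i < n}"
    using finite_imp_nat_seg_image_inj_on by blast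
  have "inj_on (\<lambda>x. c x \<circ> h) (carrier M)"
  proof (rule inj_onI)
    fix x y assume xy: "x \<in> carrier M" "y \<in> carrier M" and eq: "c x \<circ> h = c y \<circ> h"
    from eq have "c x b = c y b" if "b \<in> B" for b
      using that h by (auto simp: fun_eq_iff)
    then have "c x = c y" using PiE_ext[OF c(1)[OF xy(1)] c(1)[OF xy(2)]] by blast
    then show "x = y" using c(2) xy by metis
  qed
  then show ?thesis by blast
qed

lemma left_FP_I:
  fixes A :: "nat \<Rightarrow> ('a \<Rightarrow>\<^sub>0 int, 'm, 'd) module_scheme"
  assumes res: "partial_free_resolution (monoid_ring S) trivial_module n A d p"
  shows "left_FP n S"
proof -
  let ?R = "monoid_ring S" and ?Z = "trivial_module :: ('a \<Rightarrow>\<^sub>0 int, int) module"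
  have free: "fg_free_left_module ?R (A i)" if "i \<le> n" for i
    using res that by (simp add: partial_free_resolution_def)
  have "\<forall>i. \<exists>\<phi> :: 'm \<Rightarrow> nat \<Rightarrow> ('a \<Rightarrow>\<^sub>0 int). i \<le> n \<longrightarrow> inj_on \<phi> (carrier (A i))"
    using fg_free_left_module_embeds[OF free] by blast
  then obtain \<phi> :: "nat \<Rightarrow> 'm \<Rightarrow> nat \<Rightarrow> ('a \<Rightarrow>\<^sub>0 int)"
    where inj: "\<And>i. i \<le> n \<Longrightarrow> inj_on (\<phi> i) (carrier (A i))"
    by metis
  define \<psi> where "\<psi> i = inv_into (carrier (A i)) (\<phi> i)" for i
  define A' where "A' i = transport_module (\<phi> i) (A i)" for i
  define d' where "d' i = \<phi> (i - 1) \<circ> d i \<circ> \<psi> i" for i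
  define p' where "p' = p \<circ> \<psi> 0"
  have \<psi>: "\<psi> i (\<phi> i x) = x" if "i \<le> n" "x \<in> carrier (A i)" for i x
    using that inj by (simp add: \<psi>_def)
  have car: "carrier (A' i) = \<phi> i ` carrier (A i)" for i
    by (simp add: A'_def transport_module_simps)
  have zero: "\<zero>\<^bsub>A' i\<^esub> = \<phi> i \<zero>\<^bsub>A i\<^esub>" for i
    by (simp add: A'_def transport_module_simps)
  have ops: "x \<in> carrier (A i) \<Longrightarrow> y \<in> carrier (A i) \<Longrightarrow> \<phi> i x \<oplus>\<^bsub>A' i\<^esub> \<phi> i y = \<phi> i (x \<oplus>\<^bsub>A i\<^esub> y)"
    "x \<in> carrier (A i) \<Longrightarrow> a \<odot>\<^bsub>A' i\<^esub> \<phi> i x = \<phi> i (a \<odot>\<^bsub>A i\<^esub> x)" if "i \<le> n" for i x y a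
    using transport_module_ops[OF inj[OF that]] by (simp_all add: A'_def)
  have mods: "left_module ?R (A i)" if "i \<le> n" for i
    using free[OF that] by (simp add: fg_free_left_module_def)
  have add_cl: "x \<oplus>\<^bsub>A i\<^esub> y \<in> carrier (A i)"
    if "i \<le> n" "x \<in> carrier (A i)" "y \<in> carrier (A i)" for i x y
  proof -
    interpret left_module ?R "A i" using that by (intro mods)
    show ?thesis using that by simp
  qed
  have smult_cl: "a \<odot>\<^bsub>A i\<^esub> x \<in> carrier (A i)"
    if "i \<le> n" "a \<in> carrier ?R" "x \<in> carrier (A i)" for i a x
    using left_module.smult_closed[OF mods] that by blast
  have zero_cl: "\<zero>\<^bsub>A i\<^esub> \<in> carrier (A i)" if "i \<le> n" for i
  proof -
    interpret left_module ?R "A i" using that by (intro mods)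
    show ?thesis by simp
  qed
  have d: "d i x \<in> carrier (A (i - 1))"
    "y \<in> carrier (A i) \<Longrightarrow> d i (x \<oplus>\<^bsub>A i\<^esub> y) = d i x \<oplus>\<^bsub>A (i - 1)\<^esub> d i y"
    "a \<in> carrier ?R \<Longrightarrow> d i (a \<odot>\<^bsub>A i\<^esub> x) = a \<odot>\<^bsub>A (i - 1)\<^esub> d i x"
    if "i \<in> {1..n}" "x \<in> carrier (A i)" for i x y a
    using res that by (auto simp: partial_free_resolution_def left_module_hom_def hom_def Pi_iff)
  have p: "y \<in> carrier (A 0) \<Longrightarrow> p (x \<oplus>\<^bsub>A 0\<^esub> y) = p x \<oplus>\<^bsub>?Z\<^esub> p y"
    "a \<in> carrier ?R \<Longrightarrow> p (a \<odot>\<^bsub>A 0\<^esub> x) = a \<odot>\<^bsub>?Z\<^esub> p x"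
    if "x \<in> carrier (A 0)" for x y a
    using res that by (auto simp: partial_free_resolution_def left_module_hom_def hom_def Pi_iff)
  have "fg_free_left_module ?R (A' i)" if "i \<le> n" for i
  proof -
    from free[OF that] obtain B where "is_finite_basis ?R (A i) B" by (auto simp: fg_free_left_module_def)
    then show ?thesis
      using is_finite_basis_transport[OF mods inj] left_module_transport[OF mods inj] that
      unfolding fg_free_left_module_def A'_def by blast
  qed
  moreover have "left_module_hom ?R (A' i) (A' (i - 1)) (d' i)" if i: "i \<in> {1..n}" for i
  proof -
    from i have le: "i \<le> n" "i - 1 \<le> n" by auto
    show ?thesis
      unfolding left_module_hom_def
      by (auto simp: hom_def car d'_def \<psi>[OF le(1)] ops[OF le(1)] ops[OF le(2)] d[OF i]
          add_cl[OF le(1)] smult_cl[OF le(1)] simp del: One_nat_def)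
  qed
  moreover have "left_module_hom ?R (A' 0) ?Z p'"
    unfolding left_module_hom_def
    by (auto simp: hom_def car p'_def \<psi> ops p add_cl smult_cl)
      (simp_all add: trivial_module_def)
  moreover have "p' ` carrier (A' 0) = p ` carrier (A 0)"
    by (auto simp: car p'_def \<psi> image_image)
  moreover have "p ` carrier (A 0) = carrier ?Z"
    using res by (simp add: partial_free_resolution_def)
  moreover have "d' 1 ` carrier (A' 1) = a_kernel (A' 0) ?Z p'" if "1 \<le> n"
  proof -
    have "d' 1 ` carrier (A' 1) = \<phi> 0 ` d 1 ` carrier (A 1)"
      using that by (auto simp: car d'_def \<psi> image_image)
    also have "d 1 ` carrier (A 1) = a_kernel (A 0) ?Z p"
      using res that by (simp add: partial_free_resolution_def)
    also have "\<phi> 0 ` a_kernel (A 0) ?Z p = a_kernel (A' 0) ?Z p'"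
      by (auto simp: a_kernel_def kernel_def car p'_def \<psi>)
    finally show ?thesis .
  qed
  moreover have "d' (Suc i) ` carrier (A' (Suc i)) = a_kernel (A' i) (A' (i - 1)) (d' i)"
    if i: "i \<in> {1..<n}" for i
  proof -
    from i have le: "i \<le> n" "i - 1 \<le> n" "Suc i \<le> n" and i': "i \<in> {1..n}" by auto
    have "d' (Suc i) ` carrier (A' (Suc i)) = \<phi> i ` d (Suc i) ` carrier (A (Suc i))"
      using le by (auto simp: car d'_def \<psi> image_image)
    also have "d (Suc i) ` carrier (A (Suc i)) = a_kernel (A i) (A (i - 1)) (d i)"
      using res i by (simp add: partial_free_resolution_def)
    also have "\<phi> i ` a_kernel (A i) (A (i - 1)) (d i) = a_kernel (A' i) (A' (i - 1)) (d' i)"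
      using inj_on_eq_iff[OF inj[OF le(2)] d(1)[OF i'] zero_cl[OF le(2)]] le
      by (auto simp: a_kernel_def kernel_def car zero d'_def \<psi>)
    finally show ?thesis .
  qed
  ultimately have "partial_free_resolution ?R ?Z n A' d' p'"
    by (simp add: partial_free_resolution_def)
  then show ?thesis unfolding left_FP_def by blast
qed

end

theory Submission
  imports Defs
begin

text \<open>Let \<open>e\<close> be the identity of \<open>H\<close>.  Every left \<open>\<int>S\<close>-module \<open>M\<close> has a corner
  \<open>eM = {x. ex = x}\<close>, which is a left \<open>\<int>H\<close>-module, and \<open>M \<mapsto> eM\<close> is exact: if \<open>y\<close> lies in \<open>eN\<close> and
  \<open>y = f x\<close>, then also \<open>y = e y = f (e x)\<close> (lemmas \<open>image_corner\<close> and \<open>kernel_corner\<close>).  The corner of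
  the trivial module \<open>\<int>\<close> is \<open>\<int>\<close>.  So a partial free resolution over \<open>\<int>S\<close> turns into a partial
  resolution of \<open>\<int>\<close> over \<open>\<int>H\<close>, and it remains to see that the corner of a finitely generated free
  module is finitely generated free.  By additivity this reduces to the module \<open>e(\<int>S) = \<int>(eS)\<close>
  (lemma \<open>fg_free_corner\<close>), and that module is free over \<open>\<int>H\<close> of finite rank as soon as \<open>H\<close> acts freely
  on \<open>eS\<close> by left multiplication with finitely many orbits (lemmas \<open>unique_orbit_sum\<close> and
  \<open>left_FP_corner\<close>).

  Both properties of the action come from \<open>U\<close>.  Since \<open>e\<close> is in \<open>U\<close>, the set \<open>eS\<close> is a right ideal
  contained in \<open>U\<close>, and complete simplicity makes it a minimal one.  Hence every \<open>x\<close> in \<open>eS\<close> can be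
  multiplied on the right to give \<open>e\<close> (lemma \<open>idempotent_right_multiple\<close>).  This shows at once
  that \<open>eSe\<close> is a group, so that \<open>H = eSe\<close>, and that \<open>hx = h'x\<close> implies \<open>h = he = h'e = h'\<close>.  Finally, two
  elements \<open>x, y\<close> of \<open>eS\<close> are in the same orbit if and only if \<open>Ux = Uy\<close>: from \<open>y = ux\<close> one gets
  \<open>y = e u e x\<close> with \<open>e u e\<close> in \<open>H\<close>.  So there are no more orbits than left ideals of \<open>U\<close>.\<close>

section \<open>Bases as families\<close>

text \<open>The corner of a free module has a basis of products \<open>x b\<close>.  Bases indexed by a set, here by the
  pairs \<open>(x, b)\<close>, avoid having to know beforehand that these products are distinct.\<close>

definition finite_basis_family ::
    "('r, 'c) ring_scheme \<Rightarrow> ('r, 'm, 'd) module_scheme \<Rightarrow> 'i set \<Rightarrow> ('i \<Rightarrow> 'm) \<Rightarrow> bool"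
  where "finite_basis_family R M I v \<longleftrightarrow> finite I \<and> v \<in> I \<rightarrow> carrier M \<and>
    (\<forall>x\<in>carrier M. \<exists>!c. c \<in> I \<rightarrow>\<^sub>E carrier R \<and> x = (\<Oplus>\<^bsub>M\<^esub>i\<in>I. c i \<odot>\<^bsub>M\<^esub> v i))"

lemma (in left_module) smult_l_null [simp]:
  assumes "x \<in> carrier M"
  shows "\<zero> \<odot>\<^bsub>M\<^esub> x = \<zero>\<^bsub>M\<^esub>"
proof -
  have "\<zero> \<odot>\<^bsub>M\<^esub> x \<oplus>\<^bsub>M\<^esub> \<zero> \<odot>\<^bsub>M\<^esub> x = \<zero> \<odot>\<^bsub>M\<^esub> x"
    using smult_l_distr[of \<zero> \<zero> x] assms by simp
  then show ?thesis
    using assms by (simp add: smult_closed)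
qed

lemma (in left_module) smult_r_null [simp]:
  assumes "a \<in> carrier R"
  shows "a \<odot>\<^bsub>M\<^esub> \<zero>\<^bsub>M\<^esub> = \<zero>\<^bsub>M\<^esub>"
proof -
  have "a \<odot>\<^bsub>M\<^esub> \<zero>\<^bsub>M\<^esub> \<oplus>\<^bsub>M\<^esub> a \<odot>\<^bsub>M\<^esub> \<zero>\<^bsub>M\<^esub> = a \<odot>\<^bsub>M\<^esub> \<zero>\<^bsub>M\<^esub>"
    using smult_r_distr[of a "\<zero>\<^bsub>M\<^esub>" "\<zero>\<^bsub>M\<^esub>"] assms by simp
  then show ?thesis
    using assms by (simp add: smult_closed)
qed

lemma (in left_module) finsum_smult_right:
  assumes "finite I" "a \<in> carrier R" "f \<in> I \<rightarrow> carrier M"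
  shows "a \<odot>\<^bsub>M\<^esub> (\<Oplus>\<^bsub>M\<^esub>i\<in>I. f i) = (\<Oplus>\<^bsub>M\<^esub>i\<in>I. a \<odot>\<^bsub>M\<^esub> f i)"
  using assms
proof (induction I)
  case (insert i I)
  then have "f i \<in> carrier M" "f \<in> I \<rightarrow> carrier M" "(\<lambda>i. a \<odot>\<^bsub>M\<^esub> f i) \<in> I \<rightarrow> carrier M"
    by (auto intro: smult_closed)
  with insert show ?case
    by (simp add: smult_r_distr smult_closed)
qed simp

lemma (in left_module) finsum_smult_left:
  assumes "finite I" "x \<in> carrier M" "f \<in> I \<rightarrow> carrier R"
  shows "(\<Oplus>i\<in>I. f i) \<odot>\<^bsub>M\<^esub> x = (\<Oplus>\<^bsub>M\<^esub>i\<in>I. f i \<odot>\<^bsub>M\<^esub> x)"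
  using assms
proof (induction I)
  case (insert i I)
  then have "f i \<in> carrier R" "f \<in> I \<rightarrow> carrier R" "(\<lambda>i. f i \<odot>\<^bsub>M\<^esub> x) \<in> I \<rightarrow> carrier M"
    by (auto intro: smult_closed)
  with insert show ?case
    by (simp add: smult_l_distr smult_closed)
qed simp

lemma (in abelian_group) finsum_Times:
  assumes "finite I" "finite J" "\<And>i j. i \<in> I \<Longrightarrow> j \<in> J \<Longrightarrow> f (i, j) \<in> carrier G"
  shows "(\<Oplus>q\<in>I \<times> J. f q) = (\<Oplus>j\<in>J. \<Oplus>i\<in>I. f (i, j))"
  using assms(2,3)
proof (induction J)
  case (insert j J)
  have "(\<Oplus>q\<in>I \<times> {j}. f q) = (\<Oplus>q\<in>(\<lambda>i. (i, j)) ` I. f q)"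
    by (intro arg_cong[where f = "finsum G f"]) auto
  also have "\<dots> = (\<Oplus>i\<in>I. f (i, j))"
    using insert.prems by (intro finsum_reindex) (auto simp: inj_on_def)
  finally have col: "(\<Oplus>q\<in>I \<times> {j}. f q) = (\<Oplus>i\<in>I. f (i, j))" .
  have cl: "(\<Oplus>i\<in>I. f (i, k)) \<in> carrier G" if "k \<in> insert j J" for k
    using that insert.prems by (intro finsum_closed) auto
  have "I \<times> insert j J = I \<times> {j} \<union> I \<times> J" by auto
  then have "(\<Oplus>q\<in>I \<times> insert j J. f q) = (\<Oplus>q\<in>I \<times> {j}. f q) \<oplus> (\<Oplus>q\<in>I \<times> J. f q)"
    using insert.hyps insert.prems assms(1) by (simp only:, intro finsum_Un_disjoint) auto
  also have "\<dots> = (\<Oplus>i\<in>I. f (i, j)) \<oplus> (\<Oplus>j\<in>J. \<Oplus>i\<in>I. f (i, j))"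
    using insert by (simp add: col)
  also have "\<dots> = (\<Oplus>j\<in>insert j J. \<Oplus>i\<in>I. f (i, j))"
    using insert.hyps cl by (subst finsum_insert) auto
  finally show ?case .
qed simp

text \<open>Over a nonzero ring a basis family is injective: if \<open>v i = v j\<close>, then the unit coefficient
  functions at \<open>i\<close> and at \<open>j\<close> represent the same element and so coincide.  (Over the zero ring every
  family of zeros is a basis family.)\<close>
lemma fg_free_left_moduleI:
  assumes "left_module R M" "finite_basis_family R M I v" "\<one>\<^bsub>R\<^esub> \<noteq> \<zero>\<^bsub>R\<^esub>"
  shows "fg_free_left_module R M"
proof -
  interpret left_module R M by fact
  have I: "finite I" and v: "v \<in> I \<rightarrow> carrier M"
    and ex: "\<And>x. x \<in> carrier M \<Longrightarrow> \<exists>!c. c \<in> I \<rightarrow>\<^sub>E carrier R \<and> x = (\<Oplus>\<^bsub>M\<^esub>i\<in>I. c i \<odot>\<^bsub>M\<^esub> v i)"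
    using assms(2) by (auto simp: finite_basis_family_def)
  have inj: "inj_on v I"
  proof (rule inj_onI)
    fix i j assume ij: "i \<in> I" "j \<in> I" "v i = v j"
    define \<delta> where "\<delta> l = (\<lambda>m\<in>I. if l = m then \<one>\<^bsub>R\<^esub> else \<zero>\<^bsub>R\<^esub>)" for l
    have \<delta>: "\<delta> l \<in> I \<rightarrow>\<^sub>E carrier R" "v l = (\<Oplus>\<^bsub>M\<^esub>m\<in>I. \<delta> l m \<odot>\<^bsub>M\<^esub> v m)" if "l \<in> I" for l
    proof -
      show "\<delta> l \<in> I \<rightarrow>\<^sub>E carrier R" by (auto simp: \<delta>_def)
      have "(\<Oplus>\<^bsub>M\<^esub>m\<in>I. \<delta> l m \<odot>\<^bsub>M\<^esub> v m) = (\<Oplus>\<^bsub>M\<^esub>m\<in>I. if l = m then v m else \<zero>\<^bsub>M\<^esub>)"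
        using v that by (intro M.finsum_cong') (auto simp: \<delta>_def smult_one Pi_iff)
      then show "v l = (\<Oplus>\<^bsub>M\<^esub>m\<in>I. \<delta> l m \<odot>\<^bsub>M\<^esub> v m)"
        using M.finsum_singleton[OF that I v] by simp
    qed
    have "v i \<in> carrier M" using v ij by auto
    then have "\<delta> i = \<delta> j"
      using ex[of "v i"] \<delta>[OF ij(1)] \<delta>[OF ij(2)] ij(3) by metis
    then have "\<delta> i i = \<delta> j i" by simp
    then show "i = j" using ij assms(3) by (auto simp: \<delta>_def split: if_splits)
  qed
  have "\<exists>!c. c \<in> v ` I \<rightarrow>\<^sub>E carrier R \<and> x = (\<Oplus>\<^bsub>M\<^esub>b\<in>v ` I. c b \<odot>\<^bsub>M\<^esub> b)"
    if x: "x \<in> carrier M" for x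
  proof -
    have re: "(\<Oplus>\<^bsub>M\<^esub>b\<in>v ` I. c b \<odot>\<^bsub>M\<^esub> b) = (\<Oplus>\<^bsub>M\<^esub>i\<in>I. restrict (c \<circ> v) I i \<odot>\<^bsub>M\<^esub> v i)"
      if "c \<in> v ` I \<rightarrow>\<^sub>E carrier R" for c
    proof -
      have "(\<Oplus>\<^bsub>M\<^esub>b\<in>v ` I. c b \<odot>\<^bsub>M\<^esub> b) = (\<Oplus>\<^bsub>M\<^esub>i\<in>I. c (v i) \<odot>\<^bsub>M\<^esub> v i)"
        using that v inj by (intro M.finsum_reindex) (auto intro!: smult_closed)
      also have "\<dots> = (\<Oplus>\<^bsub>M\<^esub>i\<in>I. restrict (c \<circ> v) I i \<odot>\<^bsub>M\<^esub> v i)"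
        using that v by (intro M.finsum_cong') (auto intro!: smult_closed)
      finally show ?thesis .
    qed
    have cl: "restrict (c \<circ> v) I \<in> I \<rightarrow>\<^sub>E carrier R" if "c \<in> v ` I \<rightarrow>\<^sub>E carrier R" for c
      using that by auto
    from ex[OF x] obtain c where c: "c \<in> I \<rightarrow>\<^sub>E carrier R" "x = (\<Oplus>\<^bsub>M\<^esub>i\<in>I. c i \<odot>\<^bsub>M\<^esub> v i)"
      by blast
    define c' where "c' = restrict (c \<circ> inv_into I v) (v ` I)"
    have c': "c' \<in> v ` I \<rightarrow>\<^sub>E carrier R" using c(1) inj by (auto simp: c'_def)
    have "restrict (c' \<circ> v) I = c"
      by (rule PiE_ext[OF cl[OF c'] c(1)]) (use inj in \<open>auto simp: c'_def\<close>)
    then have x': "x = (\<Oplus>\<^bsub>M\<^esub>b\<in>v ` I. c' b \<odot>\<^bsub>M\<^esub> b)" using re[OF c'] c(2) by simp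
    show ?thesis
    proof (rule ex1I[of _ c'])
      fix k assume k: "k \<in> v ` I \<rightarrow>\<^sub>E carrier R \<and> x = (\<Oplus>\<^bsub>M\<^esub>b\<in>v ` I. k b \<odot>\<^bsub>M\<^esub> b)"
      then have k': "k \<in> v ` I \<rightarrow>\<^sub>E carrier R" by blast
      have "restrict (k \<circ> v) I = restrict (c' \<circ> v) I"
        using ex[OF x] re[OF k'] re[OF c'] cl[OF k'] cl[OF c'] k x' by metis
      then have "k (v i) = c' (v i)" if "i \<in> I" for i
        using that by (metis comp_apply restrict_apply')
      then show "k = c'" by (intro PiE_ext[OF k' c']) auto
    qed (use c' x' in blast)
  qed
  then have "is_finite_basis R M (v ` I)"
    using I v by (auto simp: is_finite_basis_def)
  then show ?thesis using assms(1) by (auto simp: fg_free_left_module_def)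
qed


section \<open>Corners of modules\<close>

text \<open>The ring \<open>K\<close> sits inside \<open>R\<close> with the same operations but with its own identity, an
  idempotent \<open>e\<close> of \<open>R\<close>.  Thus \<open>K\<close> lies in \<open>eRe\<close>, without having to be all of it.  The example in mind is
  the ring of a subgroup of a monoid, whose identity need not be that of the monoid.\<close>

locale corner_ring = R: ring R + K: ring K
  for R :: "('r, 'c) ring_scheme" and K :: "('r, 'd) ring_scheme" +
  assumes carrier_subset: "carrier K \<subseteq> carrier R"
    and mult_eq: "monoid.mult K = monoid.mult R"
    and add_eq: "add K = add R"
    and zero_eq: "\<zero>\<^bsub>K\<^esub> = \<zero>\<^bsub>R\<^esub>"

definition corner_module ::
    "('r, 'c) ring_scheme \<Rightarrow> ('r, 'm, 'd) module_scheme \<Rightarrow> ('r, 'm, 'd) module_scheme"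
  where "corner_module K M = M\<lparr>carrier := {x \<in> carrier M. \<one>\<^bsub>K\<^esub> \<odot>\<^bsub>M\<^esub> x = x}\<rparr>"

lemma corner_module_simps [simp]:
  "carrier (corner_module K M) = {x \<in> carrier M. \<one>\<^bsub>K\<^esub> \<odot>\<^bsub>M\<^esub> x = x}"
  "add (corner_module K M) = add M"
  "\<zero>\<^bsub>corner_module K M\<^esub> = \<zero>\<^bsub>M\<^esub>"
  "smult (corner_module K M) = smult M"
  by (simp_all add: corner_module_def)

context corner_ring
begin

lemma one_closed: "\<one>\<^bsub>K\<^esub> \<in> carrier R"
  using carrier_subset by auto

lemma one_mult: "k \<in> carrier K \<Longrightarrow> \<one>\<^bsub>K\<^esub> \<otimes>\<^bsub>R\<^esub> k = k"
  using K.l_one mult_eq by simp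

lemma one_smult:
  assumes "left_module R M" "k \<in> carrier K" "x \<in> carrier M"
  shows "\<one>\<^bsub>K\<^esub> \<odot>\<^bsub>M\<^esub> (k \<odot>\<^bsub>M\<^esub> x) = k \<odot>\<^bsub>M\<^esub> x"
  using left_module.smult_assoc1[OF assms(1), of "\<one>\<^bsub>K\<^esub>" k x] assms one_closed one_mult carrier_subset
  by auto

lemma left_module_corner:
  assumes "left_module R M"
  shows "left_module K (corner_module K M)"
proof -
  interpret left_module R M by fact
  have "abelian_group (corner_module K M)"
  proof (rule abelian_groupI)
    fix x assume x: "x \<in> carrier (corner_module K M)"
    then have "\<one>\<^bsub>K\<^esub> \<odot>\<^bsub>M\<^esub> (\<ominus>\<^bsub>M\<^esub> x) \<oplus>\<^bsub>M\<^esub> x = \<one>\<^bsub>K\<^esub> \<odot>\<^bsub>M\<^esub> (\<ominus>\<^bsub>M\<^esub> x \<oplus>\<^bsub>M\<^esub> x)"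
      by (simp add: smult_r_distr one_closed)
    also have "\<dots> = \<zero>\<^bsub>M\<^esub>" using x by (simp add: M.l_neg one_closed)
    finally have "\<one>\<^bsub>K\<^esub> \<odot>\<^bsub>M\<^esub> (\<ominus>\<^bsub>M\<^esub> x) = \<ominus>\<^bsub>M\<^esub> x"
      using x by (intro M.minus_equality[symmetric]) (auto simp: smult_closed one_closed)
    with x show "\<exists>y\<in>carrier (corner_module K M). y \<oplus>\<^bsub>corner_module K M\<^esub> x = \<zero>\<^bsub>corner_module K M\<^esub>"
      by (intro bexI[of _ "\<ominus>\<^bsub>M\<^esub> x"]) (auto simp: M.l_neg)
  qed (auto simp: M.a_ac smult_r_distr one_closed)
  moreover have "left_module_axioms K (corner_module K M)"
    using carrier_subset
    by unfold_locales
      (auto simp: smult_closed smult_l_distr smult_r_distr smult_assoc1 one_smult[OF assms]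
        mult_eq add_eq subset_iff)
  ultimately show ?thesis by (intro left_module.intro K.ring_axioms)
qed

lemma left_module_hom_corner:
  assumes "left_module_hom R M N f"
  shows "left_module_hom K (corner_module K M) (corner_module K N) f"
  using assms carrier_subset one_closed
  by (force simp: left_module_hom_def hom_def Pi_iff subset_iff)

text \<open>Together with \<open>kernel_corner\<close> this is the exactness of the passage to corners: images and
  kernels are both cut down by the same condition \<open>e y = y\<close>, so an equality between an image and a
  kernel survives.\<close>
lemma image_corner:
  assumes "left_module R M" "left_module R N" "left_module_hom R M N f"
  shows "f ` carrier (corner_module K M) = f ` carrier M \<inter> {y. \<one>\<^bsub>K\<^esub> \<odot>\<^bsub>N\<^esub> y = y}"
proof (intro equalityI subsetI)
  fix y assume "y \<in> f ` carrier M \<inter> {y. \<one>\<^bsub>K\<^esub> \<odot>\<^bsub>N\<^esub> y = y}"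
  then obtain x where x: "x \<in> carrier M" "y = f x" "\<one>\<^bsub>K\<^esub> \<odot>\<^bsub>N\<^esub> f x = f x" by blast
  have "f (\<one>\<^bsub>K\<^esub> \<odot>\<^bsub>M\<^esub> x) = y" 
    using assms(3) x one_closed by (auto simp: left_module_hom_def)
  moreover have "\<one>\<^bsub>K\<^esub> \<odot>\<^bsub>M\<^esub> x \<in> carrier (corner_module K M)"
    using one_smult[OF assms(1) _ x(1)] left_module.smult_closed[OF assms(1) one_closed x(1)] by simp
  ultimately show "y \<in> f ` carrier (corner_module K M)" by blast
next
  fix y assume "y \<in> f ` carrier (corner_module K M)"
  then show "y \<in> f ` carrier M \<inter> {y. \<one>\<^bsub>K\<^esub> \<odot>\<^bsub>N\<^esub> y = y}"
    using assms(3) one_closed by (auto simp: left_module_hom_def) metis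
qed

lemma kernel_corner:
  "a_kernel (corner_module K M) (corner_module K N) f = a_kernel M N f \<inter> {x. \<one>\<^bsub>K\<^esub> \<odot>\<^bsub>M\<^esub> x = x}"
  by (auto simp: a_kernel_def kernel_def)

lemma finsum_corner:
  assumes "left_module R M" "finite I" "f \<in> I \<rightarrow> carrier (corner_module K M)"
  shows "finsum (corner_module K M) f I = finsum M f I"
  using assms(2,3)
proof (induction I)
  interpret left_module R M by fact
  interpret C: left_module K "corner_module K M" by (rule left_module_corner) fact
  case empty
  then show ?case by simp
next
  interpret left_module R M by fact
  interpret C: left_module K "corner_module K M" by (rule left_module_corner) fact
  case (insert i I)
  then have "f i \<in> carrier M" "f \<in> I \<rightarrow> carrier M" "f i \<in> carrier (corner_module K M)"
      "f \<in> I \<rightarrow> carrier (corner_module K M)"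
    by auto
  with insert show ?case by (simp del: corner_module_simps(1))
qed

text \<open>The corner \<open>eR\<close> of the regular module is assumed to be free over \<open>K\<close> with basis family \<open>w\<close>.
  An element of \<open>eM\<close> has coefficients in \<open>eR\<close> with respect to an \<open>R\<close>-basis \<open>B\<close> of \<open>M\<close>; expanding these
  over \<open>K\<close> shows that the products \<open>w x \<odot> b\<close> form a \<open>K\<close>-basis of \<open>eM\<close>.\<close>
lemma fg_free_corner:
  assumes free: "fg_free_left_module R M"
    and T: "finite T" "w \<in> T \<rightarrow> carrier R" "\<And>x. x \<in> T \<Longrightarrow> \<one>\<^bsub>K\<^esub> \<otimes>\<^bsub>R\<^esub> w x = w x"
    and ex: "\<And>r. r \<in> carrier R \<Longrightarrow> \<one>\<^bsub>K\<^esub> \<otimes>\<^bsub>R\<^esub> r = r \<Longrightarrow>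
      \<exists>!k. k \<in> T \<rightarrow>\<^sub>E carrier K \<and> r = (\<Oplus>\<^bsub>R\<^esub>x\<in>T. k x \<otimes>\<^bsub>R\<^esub> w x)"
    and nontrivial: "\<one>\<^bsub>K\<^esub> \<noteq> \<zero>\<^bsub>K\<^esub>"
  shows "fg_free_left_module K (corner_module K M)"
proof -
  from free have M: "left_module R M" by (simp add: fg_free_left_module_def)
  interpret left_module R M by (fact M)
  from free obtain B where "is_finite_basis R M B" by (auto simp: fg_free_left_module_def)
  note basis_def = this[unfolded is_finite_basis_def]
  from basis_def have fin: "finite B" by (rule conjunct1)
  from basis_def have B: "B \<subseteq> carrier M" by (elim conjE)
  have basis: "\<exists>!c. c \<in> B \<rightarrow>\<^sub>E carrier R \<and> y = (\<Oplus>\<^bsub>M\<^esub>b\<in>B. c b \<odot>\<^bsub>M\<^esub> b)"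
    if "y \<in> carrier M" for y
    using basis_def[THEN conjunct2, THEN conjunct2] that by (rule bspec)
  let ?C = "corner_module K M"
  define v where "v q = w (fst q) \<odot>\<^bsub>M\<^esub> snd q" for q
  define r where "r c = (\<lambda>b\<in>B. \<Oplus>\<^bsub>R\<^esub>x\<in>T. c (x, b) \<otimes>\<^bsub>R\<^esub> w x)" for c
  have wR: "w x \<in> carrier R" if "x \<in> T" for x using T(2) that by auto
  have KR: "k \<in> carrier R" if "k \<in> carrier K" for k using carrier_subset that by auto
  have v: "v q \<in> carrier ?C" if "q \<in> T \<times> B" for q
    using that B smult_assoc1[OF one_closed wR, symmetric] T(3)
    by (auto simp: v_def wR subset_iff intro!: smult_closed)
  have prod_cl: "(\<lambda>x. c (x, b) \<otimes>\<^bsub>R\<^esub> w x) \<in> T \<rightarrow> carrier R"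
    if "c \<in> T \<times> B \<rightarrow>\<^sub>E carrier K" "b \<in> B" for c b
    using that KR wR by (auto simp: PiE_iff)
  have r: "r c \<in> B \<rightarrow>\<^sub>E carrier R" if "c \<in> T \<times> B \<rightarrow>\<^sub>E carrier K" for c
    using prod_cl[OF that] by (auto simp: r_def intro!: R.finsum_closed)
  have sum_r: "(\<Oplus>\<^bsub>?C\<^esub>q\<in>T \<times> B. c q \<odot>\<^bsub>?C\<^esub> v q) = (\<Oplus>\<^bsub>M\<^esub>b\<in>B. r c b \<odot>\<^bsub>M\<^esub> b)"
    if c: "c \<in> T \<times> B \<rightarrow>\<^sub>E carrier K" for c
  proof -
    interpret C: left_module K ?C by (rule left_module_corner) fact
    have "(\<Oplus>\<^bsub>?C\<^esub>q\<in>T \<times> B. c q \<odot>\<^bsub>?C\<^esub> v q) = (\<Oplus>\<^bsub>M\<^esub>q\<in>T \<times> B. c q \<odot>\<^bsub>?C\<^esub> v q)"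
      using c T(1) fin v by (intro finsum_corner[OF M] finite_cartesian_product Pi_I C.smult_closed) blast+
    also have "\<dots> = (\<Oplus>\<^bsub>M\<^esub>b\<in>B. \<Oplus>\<^bsub>M\<^esub>x\<in>T. c (x, b) \<odot>\<^bsub>M\<^esub> v (x, b))"
      using T(1) fin c v by (subst M.finsum_Times) (auto intro!: smult_closed KR)
    also have "\<dots> = (\<Oplus>\<^bsub>M\<^esub>b\<in>B. r c b \<odot>\<^bsub>M\<^esub> b)"
    proof (intro M.finsum_cong')
      fix b assume b: "b \<in> B"
      then have bM: "b \<in> carrier M" using B by auto
      have "(\<Oplus>\<^bsub>M\<^esub>x\<in>T. c (x, b) \<odot>\<^bsub>M\<^esub> v (x, b)) = (\<Oplus>\<^bsub>M\<^esub>x\<in>T. (c (x, b) \<otimes>\<^bsub>R\<^esub> w x) \<odot>\<^bsub>M\<^esub> b)"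
        using prod_cl[OF c b] c b bM
        by (intro M.finsum_cong') (auto simp: v_def smult_assoc1 KR wR PiE_iff intro!: smult_closed)
      also have "\<dots> = r c b \<odot>\<^bsub>M\<^esub> b"
        using b finsum_smult_left[OF T(1) bM prod_cl[OF c b]] by (simp add: r_def)
      finally show "(\<Oplus>\<^bsub>M\<^esub>x\<in>T. c (x, b) \<odot>\<^bsub>M\<^esub> v (x, b)) = r c b \<odot>\<^bsub>M\<^esub> b" .
    qed (use r[OF c] B in \<open>auto intro!: smult_closed\<close>)
    finally show ?thesis .
  qed
  have "\<exists>!c. c \<in> T \<times> B \<rightarrow>\<^sub>E carrier K \<and> y = (\<Oplus>\<^bsub>?C\<^esub>q\<in>T \<times> B. c q \<odot>\<^bsub>?C\<^esub> v q)"
    if "y \<in> carrier ?C" for y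
  proof -
    from that have y: "y \<in> carrier M" "\<one>\<^bsub>K\<^esub> \<odot>\<^bsub>M\<^esub> y = y" by auto
    from basis[OF y(1)] obtain a where a: "a \<in> B \<rightarrow>\<^sub>E carrier R" "y = (\<Oplus>\<^bsub>M\<^esub>b\<in>B. a b \<odot>\<^bsub>M\<^esub> b)"
      by blast
    have aR: "a b \<in> carrier R" if "b \<in> B" for b using a(1) that by auto
    \<comment> \<open>Multiplying the expansion of \<open>y = e y\<close> by \<open>e\<close> gives a second expansion, so by uniqueness the
      coefficients are themselves fixed by \<open>e\<close>.\<close>
    define a' where "a' = (\<lambda>b\<in>B. \<one>\<^bsub>K\<^esub> \<otimes>\<^bsub>R\<^esub> a b)"
    have a': "a' \<in> B \<rightarrow>\<^sub>E carrier R" using aR one_closed by (auto simp: a'_def)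
    have "\<one>\<^bsub>K\<^esub> \<odot>\<^bsub>M\<^esub> y = (\<Oplus>\<^bsub>M\<^esub>b\<in>B. \<one>\<^bsub>K\<^esub> \<odot>\<^bsub>M\<^esub> (a b \<odot>\<^bsub>M\<^esub> b))"
      unfolding a(2) using fin one_closed aR B
      by (intro finsum_smult_right) (auto intro!: smult_closed)
    also have "\<dots> = (\<Oplus>\<^bsub>M\<^esub>b\<in>B. a' b \<odot>\<^bsub>M\<^esub> b)"
      using one_closed aR B by (intro M.finsum_cong')
        (auto simp: a'_def smult_assoc1 subset_iff intro!: smult_closed)
    finally have "a' = a" using basis[OF y(1)] a a' y(2) by metis
    then have fix_a: "\<one>\<^bsub>K\<^esub> \<otimes>\<^bsub>R\<^esub> a b = a b" if "b \<in> B" for b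
      using that by (metis a'_def restrict_apply')
    have "\<forall>b\<in>B. \<exists>k. k \<in> T \<rightarrow>\<^sub>E carrier K \<and> a b = (\<Oplus>\<^bsub>R\<^esub>x\<in>T. k x \<otimes>\<^bsub>R\<^esub> w x)"
      by (intro ballI ex1_implies_ex ex aR fix_a)
    then obtain k where k: "\<And>b. b \<in> B \<Longrightarrow> k b \<in> T \<rightarrow>\<^sub>E carrier K"
        "\<And>b. b \<in> B \<Longrightarrow> a b = (\<Oplus>\<^bsub>R\<^esub>x\<in>T. k b x \<otimes>\<^bsub>R\<^esub> w x)"
      by metis
    define c where "c = (\<lambda>q\<in>T \<times> B. k (snd q) (fst q))"
    have c: "c \<in> T \<times> B \<rightarrow>\<^sub>E carrier K" using k(1) by (auto simp: c_def PiE_iff)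
    have "r c b = a b" if "b \<in> B" for b
    proof -
      have "(\<Oplus>\<^bsub>R\<^esub>x\<in>T. c (x, b) \<otimes>\<^bsub>R\<^esub> w x) = (\<Oplus>\<^bsub>R\<^esub>x\<in>T. k b x \<otimes>\<^bsub>R\<^esub> w x)"
        using that k(1)[OF that] by (intro R.finsum_cong') (auto simp: c_def PiE_iff KR wR)
      then show ?thesis using that k(2) by (simp add: r_def)
    qed
    then have "r c = a" by (intro PiE_ext[OF r[OF c] a(1)]) 
    then have yc: "y = (\<Oplus>\<^bsub>?C\<^esub>q\<in>T \<times> B. c q \<odot>\<^bsub>?C\<^esub> v q)" using sum_r[OF c] a(2) by simp
    show ?thesis
    proof (rule ex1I[of _ c])
      fix c' assume "c' \<in> T \<times> B \<rightarrow>\<^sub>E carrier K \<and> y = (\<Oplus>\<^bsub>?C\<^esub>q\<in>T \<times> B. c' q \<odot>\<^bsub>?C\<^esub> v q)"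
      then have c': "c' \<in> T \<times> B \<rightarrow>\<^sub>E carrier K" and "y = (\<Oplus>\<^bsub>M\<^esub>b\<in>B. r c' b \<odot>\<^bsub>M\<^esub> b)"
        using sum_r by auto
      then have "r c' = a" using basis[OF y(1)] a r by metis
      have "c' (x, b) = c (x, b)" if "x \<in> T" "b \<in> B" for x b
      proof -
        let ?s = "\<lambda>c. \<lambda>x\<in>T. c (x, b)"
        have s: "?s d \<in> T \<rightarrow>\<^sub>E carrier K \<and> a b = (\<Oplus>\<^bsub>R\<^esub>x\<in>T. ?s d x \<otimes>\<^bsub>R\<^esub> w x)"
          if d: "d \<in> T \<times> B \<rightarrow>\<^sub>E carrier K" "r d = a" for d
        proof -
          have "a b = (\<Oplus>\<^bsub>R\<^esub>x\<in>T. d (x, b) \<otimes>\<^bsub>R\<^esub> w x)"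
            using d(2) \<open>b \<in> B\<close> by (auto simp: r_def)
          also have "\<dots> = (\<Oplus>\<^bsub>R\<^esub>x\<in>T. ?s d x \<otimes>\<^bsub>R\<^esub> w x)"
            using prod_cl[OF d(1) \<open>b \<in> B\<close>] by (intro R.finsum_cong') auto
          finally show ?thesis using d(1) \<open>b \<in> B\<close> by auto
        qed
        have "?s c' = ?s c"
          using ex[OF aR[OF \<open>b \<in> B\<close>] fix_a[OF \<open>b \<in> B\<close>]] s[OF c \<open>r c = a\<close>] s[OF c' \<open>r c' = a\<close>]
          by blast
        then show ?thesis using that by (metis restrict_apply')
      qed
      then show "c' = c" by (intro PiE_ext[OF c' c]) auto
    qed (use c yc in blast)
  qed
  then have "finite_basis_family K ?C (T \<times> B) v"
    using v fin T(1) unfolding finite_basis_family_def by blast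
  then show ?thesis
    using fg_free_left_moduleI left_module_corner[OF M] nontrivial by blast
qed

lemma partial_free_resolution_corner:
  assumes res: "partial_free_resolution R N n A d p"
    and N: "left_module R N"
    and free: "\<And>i. i \<le> n \<Longrightarrow> fg_free_left_module K (corner_module K (A i))"
  shows "partial_free_resolution K (corner_module K N) n (\<lambda>i. corner_module K (A i)) d p"
proof -
  have A: "left_module R (A i)" if "i \<le> n" for i
    using res that by (simp add: partial_free_resolution_def fg_free_left_module_def)
  have d: "left_module_hom R (A i) (A (i - 1)) (d i)" if "i \<in> {1..n}" for i
    using res that by (simp add: partial_free_resolution_def)
  have p: "left_module_hom R (A 0) N p" "p ` carrier (A 0) = carrier N"
    using res by (simp_all add: partial_free_resolution_def)
  have "p ` carrier (corner_module K (A 0)) = carrier (corner_module K N)"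
    using image_corner[OF A N p(1)] p(2) by auto
  moreover have "d 1 ` carrier (corner_module K (A 1)) = a_kernel (corner_module K (A 0)) (corner_module K N) p"
    if "1 \<le> n"
    using that res image_corner[OF A A d, of 1]
    by (simp add: partial_free_resolution_def kernel_corner del: corner_module_simps)
  moreover have "d (Suc i) ` carrier (corner_module K (A (Suc i))) =
      a_kernel (corner_module K (A i)) (corner_module K (A (i - 1))) (d i)" if "i \<in> {1..<n}" for i
    using that res image_corner[OF A A d, of "Suc i"]
    by (simp add: partial_free_resolution_def kernel_corner del: corner_module_simps)
  ultimately show ?thesis
    using free left_module_hom_corner[OF d] left_module_hom_corner[OF p(1)]
    unfolding partial_free_resolution_def by simp
qed

end


section \<open>Idempotents in completely simple ideals\<close>

text \<open>If \<open>R\<close> is a minimal right ideal of a simple semigroup \<open>T\<close>, then \<open>T R\<close> is a two-sided ideal,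
  hence all of \<open>T\<close>, and each translate \<open>u R\<close> is again a minimal right ideal.  So \<open>e\<close> lies in some
  minimal right ideal \<open>u R\<close>.  This ideal contains \<open>x T = e x T\<close>, hence equals it, and therefore \<open>e\<close> is
  in \<open>x T\<close>.\<close>
lemma idempotent_right_multiple:
  assumes closed: "\<And>x y. x \<in> carrier T \<Longrightarrow> y \<in> carrier T \<Longrightarrow> x \<otimes>\<^bsub>T\<^esub> y \<in> carrier T"
    and assoc: "\<And>x y z. x \<in> carrier T \<Longrightarrow> y \<in> carrier T \<Longrightarrow> z \<in> carrier T \<Longrightarrow>
      x \<otimes>\<^bsub>T\<^esub> y \<otimes>\<^bsub>T\<^esub> z = x \<otimes>\<^bsub>T\<^esub> (y \<otimes>\<^bsub>T\<^esub> z)"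
    and simple: "simple_semigroup T"
    and min: "minimal_set (right_ideal T) R"
    and e: "e \<in> carrier T" "e \<otimes>\<^bsub>T\<^esub> e = e"
    and x: "x \<in> carrier T" "e \<otimes>\<^bsub>T\<^esub> x = x"
  shows "\<exists>t\<in>carrier T. x \<otimes>\<^bsub>T\<^esub> t = e"
proof -
  have R: "right_ideal T R" and R_min: "\<And>J. right_ideal T J \<Longrightarrow> J \<subseteq> R \<Longrightarrow> J = R"
    using min by (auto simp: minimal_set_def)
  have RT: "r \<in> carrier T" if "r \<in> R" for r using R that by (auto simp: right_ideal_def)
  have Rm: "r \<otimes>\<^bsub>T\<^esub> t \<in> R" if "r \<in> R" "t \<in> carrier T" for r t
    using R that by (auto simp: right_ideal_def)
  obtain r0 where r0: "r0 \<in> R" using R by (auto simp: right_ideal_def)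
  define I where "I = {u \<otimes>\<^bsub>T\<^esub> r | u r. u \<in> carrier T \<and> r \<in> R}"
  have "two_sided_ideal T I"
    unfolding two_sided_ideal_def left_ideal_def right_ideal_def
  proof (intro conjI ballI)
    show "I \<subseteq> carrier T" using closed RT by (auto simp: I_def)
    then show "I \<subseteq> carrier T" .
    show "I \<noteq> {}" using e(1) r0 by (auto simp: I_def)
    then show "I \<noteq> {}" .
    fix s y assume s: "s \<in> carrier T" and "y \<in> I"
    then obtain u r where ur: "u \<in> carrier T" "r \<in> R" "y = u \<otimes>\<^bsub>T\<^esub> r" by (auto simp: I_def)
    then have "s \<otimes>\<^bsub>T\<^esub> y = (s \<otimes>\<^bsub>T\<^esub> u) \<otimes>\<^bsub>T\<^esub> r" "y \<otimes>\<^bsub>T\<^esub> s = u \<otimes>\<^bsub>T\<^esub> (r \<otimes>\<^bsub>T\<^esub> s)"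
      using assoc s RT by simp_all
    then show "s \<otimes>\<^bsub>T\<^esub> y \<in> I" "y \<otimes>\<^bsub>T\<^esub> s \<in> I" using ur s closed Rm unfolding I_def by blast+
  qed
  then have "I = carrier T" using simple by (simp add: simple_semigroup_def)
  then obtain u r1 where u: "u \<in> carrier T" "r1 \<in> R" "e = u \<otimes>\<^bsub>T\<^esub> r1" using e(1) unfolding I_def by blast
  \<comment> \<open>The preimage of \<open>x T\<close> under \<open>r \<mapsto> u r\<close>.  Minimality of \<open>R\<close> forces it to be all of \<open>R\<close>, which
    replaces the minimality of \<open>u R\<close>.\<close>
  define J where "J = {r \<in> R. \<exists>t\<in>carrier T. u \<otimes>\<^bsub>T\<^esub> r = x \<otimes>\<^bsub>T\<^esub> t}"
  have "right_ideal T J"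
    unfolding right_ideal_def
  proof (intro conjI ballI)
    show "J \<subseteq> carrier T" using RT by (auto simp: J_def)
    \<comment> \<open>The witness \<open>r1 x e\<close> is mapped to \<open>u r1 x e = e x e = x e\<close>.\<close>
    have "u \<otimes>\<^bsub>T\<^esub> (r1 \<otimes>\<^bsub>T\<^esub> (x \<otimes>\<^bsub>T\<^esub> e)) = e \<otimes>\<^bsub>T\<^esub> (x \<otimes>\<^bsub>T\<^esub> e)"
      using assoc[of u r1 "x \<otimes>\<^bsub>T\<^esub> e"] u x(1) e(1) RT closed by simp
    also have "\<dots> = x \<otimes>\<^bsub>T\<^esub> e" using assoc[of e x e] e x by simp
    finally show "J \<noteq> {}" using Rm[OF u(2), of "x \<otimes>\<^bsub>T\<^esub> e"] closed x(1) e(1) by (auto simp: J_def)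
    fix s y assume s: "s \<in> carrier T" and "y \<in> J"
    then obtain t where t: "y \<in> R" "t \<in> carrier T" "u \<otimes>\<^bsub>T\<^esub> y = x \<otimes>\<^bsub>T\<^esub> t" by (auto simp: J_def)
    have "u \<otimes>\<^bsub>T\<^esub> (y \<otimes>\<^bsub>T\<^esub> s) = (u \<otimes>\<^bsub>T\<^esub> y) \<otimes>\<^bsub>T\<^esub> s"
      using assoc u(1) t(1) s RT by simp
    also have "\<dots> = x \<otimes>\<^bsub>T\<^esub> (t \<otimes>\<^bsub>T\<^esub> s)" using assoc t s x(1) by simp
    finally show "y \<otimes>\<^bsub>T\<^esub> s \<in> J" using t s Rm closed by (auto simp: J_def)
  qed
  then have "J = R" by (rule R_min) (auto simp: J_def)
  then have "r1 \<in> J" using u(2) by simp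
  then show ?thesis using u(3) by (auto simp: J_def)
qed

text \<open>If \<open>x t = e\<close> with \<open>x\<close> in \<open>eSe\<close>, then \<open>e t e\<close> is a right inverse of \<open>x\<close> inside \<open>eSe\<close>.  A monoid
  in which every element has a right inverse is a group, so \<open>eSe\<close> consists of units.\<close>
lemma Units_local_monoid:
  assumes "monoid S" "e \<in> carrier S" "e \<otimes>\<^bsub>S\<^esub> e = e"
    and inv: "\<And>x. x \<in> carrier S \<Longrightarrow> e \<otimes>\<^bsub>S\<^esub> x = x \<Longrightarrow> \<exists>t\<in>carrier S. x \<otimes>\<^bsub>S\<^esub> t = e"
  shows "group (units_of (local_monoid S e))"
    and "Units (local_monoid S e) = {x \<in> carrier S. e \<otimes>\<^bsub>S\<^esub> x = x \<and> x \<otimes>\<^bsub>S\<^esub> e = x}"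
proof -
  interpret S: monoid S by fact
  let ?L = "local_monoid S e"
  let ?C = "{x \<in> carrier S. e \<otimes>\<^bsub>S\<^esub> x = x \<and> x \<otimes>\<^bsub>S\<^esub> e = x}"
  have "carrier ?L = ?C"
  proof (intro equalityI subsetI)
    fix x assume "x \<in> carrier ?L"
    then obtain s where s: "s \<in> carrier S" "x = e \<otimes>\<^bsub>S\<^esub> s \<otimes>\<^bsub>S\<^esub> e" by (auto simp: local_monoid_def)
    have "e \<otimes>\<^bsub>S\<^esub> x = (e \<otimes>\<^bsub>S\<^esub> e) \<otimes>\<^bsub>S\<^esub> s \<otimes>\<^bsub>S\<^esub> e" unfolding s(2) using s(1) assms(2) by (simp add: S.m_assoc)
    moreover have "x \<otimes>\<^bsub>S\<^esub> e = e \<otimes>\<^bsub>S\<^esub> s \<otimes>\<^bsub>S\<^esub> (e \<otimes>\<^bsub>S\<^esub> e)" unfolding s(2) using s(1) assms(2) by (simp add: S.m_assoc)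
    ultimately show "x \<in> ?C" using s assms(2,3) by simp
  next
    fix x assume "x \<in> ?C"
    then have "x \<in> carrier S" "x = e \<otimes>\<^bsub>S\<^esub> x \<otimes>\<^bsub>S\<^esub> e" by auto
    then show "x \<in> carrier ?L" unfolding local_monoid_def by auto
  qed
  then have L: "carrier ?L = ?C" "monoid.mult ?L = monoid.mult S" "\<one>\<^bsub>?L\<^esub> = e"
    by (simp_all add: local_monoid_def)
  have C_mult: "x \<otimes>\<^bsub>S\<^esub> y \<in> ?C" if "x \<in> ?C" "y \<in> ?C" for x y
    using that assms(2) S.m_assoc[of e x y] S.m_assoc[of x y e] by auto
  have mon: "monoid ?L"
    by (rule monoidI) (use C_mult assms in \<open>auto simp: L S.m_assoc\<close>)
  then interpret L: monoid ?L .
  show "group (units_of ?L)" by (rule L.units_group)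
  have rinv: "\<exists>y\<in>?C. x \<otimes>\<^bsub>S\<^esub> y = e" if x: "x \<in> ?C" for x
  proof -
    obtain t where t: "t \<in> carrier S" "x \<otimes>\<^bsub>S\<^esub> t = e" using inv x by blast
    have "x \<otimes>\<^bsub>S\<^esub> (e \<otimes>\<^bsub>S\<^esub> t \<otimes>\<^bsub>S\<^esub> e) = (x \<otimes>\<^bsub>S\<^esub> e) \<otimes>\<^bsub>S\<^esub> t \<otimes>\<^bsub>S\<^esub> e"
      using x t(1) assms(2) S.m_assoc[of x e "t \<otimes>\<^bsub>S\<^esub> e"] by (auto simp: S.m_assoc)
    also have "\<dots> = e" using x t assms(3) by simp
    finally have "x \<otimes>\<^bsub>S\<^esub> (e \<otimes>\<^bsub>S\<^esub> t \<otimes>\<^bsub>S\<^esub> e) = e" .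
    moreover have "e \<otimes>\<^bsub>S\<^esub> t \<otimes>\<^bsub>S\<^esub> e \<in> ?C" 
      using t(1) unfolding L(1)[symmetric] by (auto simp: local_monoid_def)
    ultimately show ?thesis by blast
  qed
  have "x \<in> Units ?L" if x: "x \<in> ?C" for x
  proof -
    obtain y where y: "y \<in> ?C" "x \<otimes>\<^bsub>S\<^esub> y = e" using rinv[OF x] by blast
    obtain z where z: "z \<in> ?C" "y \<otimes>\<^bsub>S\<^esub> z = e" using rinv[OF y(1)] by blast
    have "x = z" using L.inv_unique[of x y z] x y z by (simp add: L)
    then show ?thesis unfolding Units_def L using x y z by blast
  qed
  then show "Units ?L = ?C" unfolding Units_def L by blast
qed

text \<open>The map \<open>orb\<close> is a complete invariant of the orbits of \<open>H\<close> on \<open>Y\<close>; one element is chosen for each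
  of its finitely many values.  The action is free because \<open>y t = 1\<close>, with \<open>1\<close> the identity of \<open>H\<close>, lets
  one recover \<open>h = h y t\<close> from \<open>h y\<close>.\<close>
lemma orbit_transversal:
  assumes "monoid S" and H: "monoid H" "carrier H \<subseteq> carrier S" "monoid.mult H = monoid.mult S"
    and act: "\<And>h y. h \<in> carrier H \<Longrightarrow> y \<in> Y \<Longrightarrow> h \<otimes>\<^bsub>S\<^esub> y \<in> Y"
    and Y: "Y \<subseteq> carrier S" "\<And>y. y \<in> Y \<Longrightarrow> \<one>\<^bsub>H\<^esub> \<otimes>\<^bsub>S\<^esub> y = y"
    and free: "\<And>y. y \<in> Y \<Longrightarrow> \<exists>t\<in>carrier S. y \<otimes>\<^bsub>S\<^esub> t = \<one>\<^bsub>H\<^esub>"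
    and fin: "finite (orb ` Y)"
    and orb: "\<And>y z. y \<in> Y \<Longrightarrow> z \<in> Y \<Longrightarrow> orb y = orb z \<longleftrightarrow> (\<exists>h\<in>carrier H. y = h \<otimes>\<^bsub>S\<^esub> z)"
  shows "\<exists>T. finite T \<and> T \<subseteq> Y \<and> bij_betw (\<lambda>(h, x). h \<otimes>\<^bsub>S\<^esub> x) (carrier H \<times> T) Y"
proof -
  interpret S: monoid S by fact
  interpret H: monoid H by fact
  define T where "T = inv_into Y orb ` orb ` Y"
  have TY: "T \<subseteq> Y" by (auto simp: T_def inv_into_into)
  have inj: "inj_on orb T"
    unfolding T_def by (rule inj_onI) (auto simp: f_inv_into_f)
  have "inj_on (\<lambda>(h, x). h \<otimes>\<^bsub>S\<^esub> x) (carrier H \<times> T)"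
  proof (rule inj_onI, clarsimp)
    fix h x h' x'
    assume h: "h \<in> carrier H" "h' \<in> carrier H" and x: "x \<in> T" "x' \<in> T"
      and eq: "h \<otimes>\<^bsub>S\<^esub> x = h' \<otimes>\<^bsub>S\<^esub> x'"
    have xY: "x \<in> Y" "x' \<in> Y" using x TY by auto
    have "orb (h \<otimes>\<^bsub>S\<^esub> x) = orb x" "orb (h' \<otimes>\<^bsub>S\<^esub> x') = orb x'"
      using orb[OF act] h xY by blast+
    then have "x = x'" using eq inj x by (auto dest: inj_onD)
    moreover obtain t where t: "t \<in> carrier S" "x \<otimes>\<^bsub>S\<^esub> t = \<one>\<^bsub>H\<^esub>" using free xY by blast
    have "g = g \<otimes>\<^bsub>S\<^esub> x \<otimes>\<^bsub>S\<^esub> t" if "g \<in> carrier H" for g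
      using that t xY Y H H.r_one[OF that] by (auto simp: S.m_assoc subset_iff)
    ultimately show "h = h' \<and> x = x'" using h eq by metis
  qed
  moreover have "(\<lambda>(h, x). h \<otimes>\<^bsub>S\<^esub> x) ` (carrier H \<times> T) = Y"
  proof (intro equalityI subsetI)
    fix y assume y: "y \<in> Y"
    let ?x = "inv_into Y orb (orb y)"
    have x: "?x \<in> T" "?x \<in> Y" using y by (auto simp: T_def inv_into_into)
    have "orb y = orb ?x" using y by (simp add: f_inv_into_f)
    then obtain h where "h \<in> carrier H" "y = h \<otimes>\<^bsub>S\<^esub> ?x" using orb[OF y x(2)] by blast
    then show "y \<in> (\<lambda>(h, x). h \<otimes>\<^bsub>S\<^esub> x) ` (carrier H \<times> T)" using x(1) by force
  qed (use act TY in auto)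
  ultimately show ?thesis using fin TY unfolding bij_betw_def T_def by blast
qed


section \<open>The free module spanned by a free action\<close>

lemma carrier_monoid_ring: "carrier (monoid_ring S) = {f. Poly_Mapping.keys f \<subseteq> carrier S}"
  by (simp add: monoid_ring_def)

lemma finsum_monoid_ring:
  assumes "monoid S" "finite I" "f \<in> I \<rightarrow> carrier (monoid_ring S)"
  shows "finsum (monoid_ring S) f I = sum f I"
  using assms(2,3)
proof (induction I)
  interpret R: ring "monoid_ring S" by (rule ring_monoid_ring) fact
  case empty
  have "\<zero>\<^bsub>monoid_ring S\<^esub> = 0" by (simp add: monoid_ring_def)
  then show ?case by simp
next
  interpret R: ring "monoid_ring S" by (rule ring_monoid_ring) fact
  case (insert i I)
  then have "f i \<in> carrier (monoid_ring S)" "f \<in> I \<rightarrow> carrier (monoid_ring S)" by auto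
  moreover have "add (monoid_ring S) = (+)" by (simp add: monoid_ring_def)
  ultimately show ?case using insert by simp
qed

text \<open>The element \<open>h x\<close> arises from no pair other than \<open>(h, x)\<close>, so its coefficient in the sum is a
  single coefficient of \<open>k x\<close>.\<close>
lemma lookup_orbit_sum:
  assumes T: "finite T" and inj: "inj_on (\<lambda>(h, x). h \<otimes>\<^bsub>S\<^esub> x) (G \<times> T)"
    and k: "\<And>x. x \<in> T \<Longrightarrow> Poly_Mapping.keys (k x) \<subseteq> G" and h: "h \<in> G" and x: "x \<in> T"
  shows "Poly_Mapping.lookup (\<Sum>x\<in>T. k x \<otimes>\<^bsub>monoid_ring S\<^esub> Poly_Mapping.single x 1) (h \<otimes>\<^bsub>S\<^esub> x) =
    Poly_Mapping.lookup (k x) h"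
proof -
  have "Poly_Mapping.lookup (k z \<otimes>\<^bsub>monoid_ring S\<^esub> Poly_Mapping.single z 1) (h \<otimes>\<^bsub>S\<^esub> x) =
      (if z = x then Poly_Mapping.lookup (k x) h else 0)" if z: "z \<in> T" for z
  proof -
    have "Poly_Mapping.lookup (k z \<otimes>\<^bsub>monoid_ring S\<^esub> Poly_Mapping.single z 1) (h \<otimes>\<^bsub>S\<^esub> x) =
        (\<Sum>g\<in>Poly_Mapping.keys (k z). Poly_Mapping.lookup (k z) g when g \<otimes>\<^bsub>S\<^esub> z = h \<otimes>\<^bsub>S\<^esub> x)"
      by (simp add: mult_monoid_ring_eq[of "Poly_Mapping.keys (k z)" "{z}"] lookup_sum lookup_single)
    also have "\<dots> = (\<Sum>g\<in>Poly_Mapping.keys (k z).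
        if g = h then (if z = x then Poly_Mapping.lookup (k x) h else 0) else 0)"
    proof (intro sum.cong refl)
      fix g assume "g \<in> Poly_Mapping.keys (k z)"
      then have "g \<in> G" using k[OF z] by blast
      then have "g \<otimes>\<^bsub>S\<^esub> z = h \<otimes>\<^bsub>S\<^esub> x \<longleftrightarrow> g = h \<and> z = x"
        using inj_onD[OF inj, of "(g, z)" "(h, x)"] h x z by auto
      then show "(Poly_Mapping.lookup (k z) g when g \<otimes>\<^bsub>S\<^esub> z = h \<otimes>\<^bsub>S\<^esub> x) =
          (if g = h then (if z = x then Poly_Mapping.lookup (k x) h else 0) else 0)"
        by (auto simp: when_def)
    qed
    also have "\<dots> = (if z = x then Poly_Mapping.lookup (k x) h else 0)"
      by (auto simp: in_keys_iff)
    finally show ?thesis .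
  qed
  then show ?thesis using T x by (simp add: lookup_sum)
qed

text \<open>If \<open>Y\<close> is a disjoint union of free orbits with representatives \<open>T\<close>, then the elements of \<open>T\<close> form
  a basis of the module of formal sums over \<open>Y\<close>: by \<open>lookup_orbit_sum\<close> the coefficient of \<open>r\<close> at \<open>h x\<close>
  has to be, and can be taken as, the coefficient of \<open>k x\<close> at \<open>h\<close>.\<close>
lemma unique_orbit_sum:
  assumes T: "finite T" and bij: "bij_betw (\<lambda>(h, x). h \<otimes>\<^bsub>S\<^esub> x) (G \<times> T) Y"
    and r: "Poly_Mapping.keys r \<subseteq> Y"
  shows "\<exists>!k. k \<in> T \<rightarrow>\<^sub>E {f. Poly_Mapping.keys f \<subseteq> G} \<and>
    r = (\<Sum>x\<in>T. k x \<otimes>\<^bsub>monoid_ring S\<^esub> Poly_Mapping.single x 1)"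
proof -
  let ?F = "{f. Poly_Mapping.keys f \<subseteq> G}"
  let ?sum = "\<lambda>k. \<Sum>x\<in>T. k x \<otimes>\<^bsub>monoid_ring S\<^esub> Poly_Mapping.single x 1"
  have inj: "inj_on (\<lambda>(h, x). h \<otimes>\<^bsub>S\<^esub> x) (G \<times> T)" and im: "(\<lambda>(h, x). h \<otimes>\<^bsub>S\<^esub> x) ` (G \<times> T) = Y"
    using bij by (auto simp: bij_betw_def)
  have coeff: "Poly_Mapping.lookup (?sum k) (h \<otimes>\<^bsub>S\<^esub> x) = Poly_Mapping.lookup (k x) h"
    if "k \<in> T \<rightarrow>\<^sub>E ?F" "h \<in> G" "x \<in> T" for k h x
    using lookup_orbit_sum[OF T inj _ that(2,3)] that(1) by (auto simp: PiE_iff)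
  define k where "k = (\<lambda>x\<in>T. Abs_poly_mapping (\<lambda>h. Poly_Mapping.lookup r (h \<otimes>\<^bsub>S\<^esub> x) when h \<in> G))"
  have k_lookup: "Poly_Mapping.lookup (k x) h = (Poly_Mapping.lookup r (h \<otimes>\<^bsub>S\<^esub> x) when h \<in> G)"
    if x: "x \<in> T" for x h
  proof -
    have "inj_on (\<lambda>h. h \<otimes>\<^bsub>S\<^esub> x) {h \<in> G. h \<otimes>\<^bsub>S\<^esub> x \<in> Poly_Mapping.keys r}"
      using inj x by (auto simp: inj_on_def)
    then have "finite {h \<in> G. h \<otimes>\<^bsub>S\<^esub> x \<in> Poly_Mapping.keys r}"
      by (rule inj_on_finite[of _ _ "Poly_Mapping.keys r"]) auto
    then have "finite {h. (Poly_Mapping.lookup r (h \<otimes>\<^bsub>S\<^esub> x) when h \<in> G) \<noteq> 0}"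
      by (rule rev_finite_subset) (auto simp: when_def in_keys_iff)
    then show ?thesis using x by (simp add: k_def)
  qed
  have kF: "k \<in> T \<rightarrow>\<^sub>E ?F"
  proof (rule PiE_I)
    fix x assume "x \<in> T"
    then show "k x \<in> ?F" using k_lookup[of x] by (auto simp: in_keys_iff when_def) (metis (full_types))
  qed (simp add: k_def)
  have "Poly_Mapping.keys (k x \<otimes>\<^bsub>monoid_ring S\<^esub> Poly_Mapping.single x 1) \<subseteq> Y" if x: "x \<in> T" for x
  proof -
    have "k x \<otimes>\<^bsub>monoid_ring S\<^esub> Poly_Mapping.single x 1 =
        (\<Sum>g\<in>Poly_Mapping.keys (k x). Poly_Mapping.single (g \<otimes>\<^bsub>S\<^esub> x) (Poly_Mapping.lookup (k x) g))"
      by (simp add: mult_monoid_ring_eq[of "Poly_Mapping.keys (k x)" "{x}"])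
    also have "Poly_Mapping.keys \<dots> \<subseteq> Y"
      using kF x im by (intro keys_sum_subset) auto
    finally show ?thesis .
  qed
  then have keys: "Poly_Mapping.keys (?sum k) \<subseteq> Y" by (rule keys_sum_subset)
  have "r = ?sum k"
  proof (rule poly_mapping_eqI)
    fix y
    show "Poly_Mapping.lookup r y = Poly_Mapping.lookup (?sum k) y"
    proof (cases "y \<in> Y")
      case True
      then obtain h x where "h \<in> G" "x \<in> T" "y = h \<otimes>\<^bsub>S\<^esub> x" using im by auto
      then show ?thesis using coeff[OF kF] k_lookup by simp
    next
      case False
      then have "y \<notin> Poly_Mapping.keys r" "y \<notin> Poly_Mapping.keys (?sum k)" using r keys by auto
      then show ?thesis by (simp add: in_keys_iff)
    qed
  qed
  moreover have "k' = k" if k': "k' \<in> T \<rightarrow>\<^sub>E ?F" "r = ?sum k'" for k'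
  proof (rule PiE_ext[OF k'(1) kF], rule poly_mapping_eqI)
    fix x h assume x: "x \<in> T"
    show "Poly_Mapping.lookup (k' x) h = Poly_Mapping.lookup (k x) h"
    proof (cases "h \<in> G")
      case True
      then show ?thesis using coeff[OF k'(1) True x] k'(2) k_lookup[OF x] by simp
    next
      case False
      have "Poly_Mapping.keys (k' x) \<subseteq> G" using k'(1) x by auto
      then have "h \<notin> Poly_Mapping.keys (k' x)" using False by blast
      then show ?thesis using False k_lookup[OF x] by (simp add: in_keys_iff)
    qed
  qed
  ultimately show ?thesis using kF by (intro ex1I[of _ k]) auto
qed

text \<open>So the elements of \<open>e(\<int>S)\<close> are formal sums over \<open>eS\<close>.\<close>
lemma keys_fixed_subset:
  assumes "Poly_Mapping.single e 1 \<otimes>\<^bsub>monoid_ring S\<^esub> r = r"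
  shows "Poly_Mapping.keys r \<subseteq> (\<lambda>s. e \<otimes>\<^bsub>S\<^esub> s) ` Poly_Mapping.keys r"
proof -
  have "Poly_Mapping.single e 1 \<otimes>\<^bsub>monoid_ring S\<^esub> r =
      (\<Sum>a\<in>Poly_Mapping.keys r. Poly_Mapping.single (e \<otimes>\<^bsub>S\<^esub> a) (Poly_Mapping.lookup r a))"
    by (simp add: mult_monoid_ring_eq[of "{e}" "Poly_Mapping.keys r"])
  moreover have "Poly_Mapping.keys \<dots> \<subseteq> (\<lambda>s. e \<otimes>\<^bsub>S\<^esub> s) ` Poly_Mapping.keys r"
    by (intro keys_sum_subset) auto
  ultimately show ?thesis using assms by simp
qed


section \<open>Finiteness properties of the maximal subgroup\<close>

text \<open>Here \<open>T\<close> represents the orbits of \<open>H\<close> on \<open>eS\<close>, where \<open>e\<close> is the identity of \<open>H\<close>.  So \<open>e(\<int>S)\<close> is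
  free over \<open>\<int>H\<close> with basis \<open>T\<close>, and passing to corners turns a resolution over \<open>\<int>S\<close> into one over
  \<open>\<int>H\<close>.\<close>
lemma left_FP_corner:
  assumes "monoid S" "left_FP n S"
    and H: "monoid H" "carrier H \<subseteq> carrier S" "monoid.mult H = monoid.mult S"
    and T: "finite T" "T \<subseteq> {s \<in> carrier S. \<one>\<^bsub>H\<^esub> \<otimes>\<^bsub>S\<^esub> s = s}"
      "bij_betw (\<lambda>(h, x). h \<otimes>\<^bsub>S\<^esub> x) (carrier H \<times> T) {s \<in> carrier S. \<one>\<^bsub>H\<^esub> \<otimes>\<^bsub>S\<^esub> s = s}"
  shows "left_FP n H"
proof -
  interpret S: monoid S by fact
  interpret H: monoid H by fact
  let ?R = "monoid_ring S" and ?K = "monoid_ring H" and ?Z = "trivial_module :: ('a \<Rightarrow>\<^sub>0 int, int) module"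
  let ?Y = "{s \<in> carrier S. \<one>\<^bsub>H\<^esub> \<otimes>\<^bsub>S\<^esub> s = s}"
  interpret corner_ring ?R ?K
    by (intro corner_ring.intro corner_ring_axioms.intro ring_monoid_ring S.monoid_axioms H.monoid_axioms)
      (use H in \<open>auto simp: monoid_ring_def\<close>)
  have one: "\<one>\<^bsub>?K\<^esub> = Poly_Mapping.single \<one>\<^bsub>H\<^esub> 1" by (simp add: monoid_ring_def)
  have e: "\<one>\<^bsub>H\<^esub> \<in> carrier S" "\<one>\<^bsub>H\<^esub> \<otimes>\<^bsub>S\<^esub> \<one>\<^bsub>H\<^esub> = \<one>\<^bsub>H\<^esub>"
    using H(2,3) H.r_one[of "\<one>\<^bsub>H\<^esub>"] by auto
  have TY: "x \<in> ?Y" if "x \<in> T" for x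
    using T(2) that by blast
  have fixed_keys: "Poly_Mapping.keys r \<subseteq> ?Y"
    if "r \<in> carrier ?R" "\<one>\<^bsub>?K\<^esub> \<otimes>\<^bsub>?R\<^esub> r = r" for r
  proof -
    have "\<one>\<^bsub>H\<^esub> \<otimes>\<^bsub>S\<^esub> s \<in> ?Y" if "s \<in> carrier S" for s
      using that e S.m_assoc[OF e(1) e(1) that] by simp
    then show ?thesis
      using keys_fixed_subset[of S "\<one>\<^bsub>H\<^esub>" r] that by (auto simp: one carrier_monoid_ring)
  qed
  have free: "fg_free_left_module ?K (corner_module ?K M)"
    if "fg_free_left_module ?R M" for M :: "('a \<Rightarrow>\<^sub>0 int, nat \<Rightarrow> ('a \<Rightarrow>\<^sub>0 int)) module"
  proof (rule fg_free_corner[OF that T(1), of "\<lambda>x. Poly_Mapping.single x 1"])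
    show "(\<lambda>x. Poly_Mapping.single x 1) \<in> T \<rightarrow> carrier ?R"
      using TY by (auto simp: carrier_monoid_ring)
    show "\<one>\<^bsub>?K\<^esub> \<otimes>\<^bsub>?R\<^esub> Poly_Mapping.single x 1 = Poly_Mapping.single x 1" if "x \<in> T" for x
      using TY[OF that] by (simp add: one monoid_ring_mult_single)
    show "\<one>\<^bsub>?K\<^esub> \<noteq> \<zero>\<^bsub>?K\<^esub>" by (simp add: monoid_ring_def)
    fix r assume r: "r \<in> carrier ?R" "\<one>\<^bsub>?K\<^esub> \<otimes>\<^bsub>?R\<^esub> r = r"
    have sum: "(\<Oplus>\<^bsub>?R\<^esub>x\<in>T. k x \<otimes>\<^bsub>?R\<^esub> Poly_Mapping.single x 1) =
        (\<Sum>x\<in>T. k x \<otimes>\<^bsub>?R\<^esub> Poly_Mapping.single x 1)" if "k \<in> T \<rightarrow>\<^sub>E carrier ?K" for k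
    proof (rule finsum_monoid_ring[OF S.monoid_axioms T(1)])
      have "Poly_Mapping.single x 1 \<in> carrier ?R" if "x \<in> T" for x
        using TY that by (auto simp: carrier_monoid_ring)
      then show "(\<lambda>x. k x \<otimes>\<^bsub>?R\<^esub> Poly_Mapping.single x 1) \<in> T \<rightarrow> carrier ?R"
        using that carrier_subset by (auto intro!: R.m_closed)
    qed
    show "\<exists>!k. k \<in> T \<rightarrow>\<^sub>E carrier ?K \<and> r = (\<Oplus>\<^bsub>?R\<^esub>x\<in>T. k x \<otimes>\<^bsub>?R\<^esub> Poly_Mapping.single x 1)"
    proof -
      let ?P = "\<lambda>k. k \<in> T \<rightarrow>\<^sub>E carrier ?K \<and> r = (\<Sum>x\<in>T. k x \<otimes>\<^bsub>?R\<^esub> Poly_Mapping.single x 1)"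
      have "\<exists>!k. ?P k"
        using unique_orbit_sum[OF T(1,3) fixed_keys[OF r]] by (simp only: carrier_monoid_ring)
      moreover have "?P k \<longleftrightarrow> k \<in> T \<rightarrow>\<^sub>E carrier ?K \<and>
          r = (\<Oplus>\<^bsub>?R\<^esub>x\<in>T. k x \<otimes>\<^bsub>?R\<^esub> Poly_Mapping.single x 1)" for k
        using sum[of k] by (intro conj_cong refl) simp
      ultimately show ?thesis by simp
    qed
  qed
  obtain A :: "nat \<Rightarrow> ('a \<Rightarrow>\<^sub>0 int, nat \<Rightarrow> ('a \<Rightarrow>\<^sub>0 int)) module" and d p
    where res: "partial_free_resolution ?R ?Z n A d p"
    using assms(2) unfolding left_FP_def by blast
  have "corner_module ?K ?Z = ?Z"
    by (simp add: corner_module_def one trivial_module_def)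
  moreover have "partial_free_resolution ?K (corner_module ?K ?Z) n (\<lambda>i. corner_module ?K (A i)) d p"
    using res by (intro partial_free_resolution_corner left_module_trivial_module S.monoid_axioms free)
      (auto simp: partial_free_resolution_def)
  ultimately show ?thesis unfolding left_FP_def by metis
qed

theorem theorem2:
  fixes S :: "('a, 'b) monoid_scheme" and U :: "'a set" and H :: "'a monoid" and n :: nat
  assumes "monoid S"
    and "minimal_ideal S U"
    and "completely_simple (S\<lparr>carrier := U\<rparr>)"
    and "maximal_subgroup S H"
    and "carrier H \<subseteq> U"
    and "left_FP n S"
    and "finite {L. left_ideal (S\<lparr>carrier := U\<rparr>) L}"
  shows "type_FP n H"
proof -
  interpret S: monoid S by fact
  let ?U = "S\<lparr>carrier := U\<rparr>"
  have U: "two_sided_ideal S U" using assms(2) by (simp add: minimal_set_def)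
  have US: "u \<in> carrier S" if "u \<in> U" for u
    using U that by (auto simp: two_sided_ideal_def left_ideal_def)
  have U_left: "s \<otimes>\<^bsub>S\<^esub> u \<in> U" and U_right: "u \<otimes>\<^bsub>S\<^esub> s \<in> U" if "s \<in> carrier S" "u \<in> U" for s u
    using U that by (auto simp: two_sided_ideal_def left_ideal_def right_ideal_def)
  obtain e where e: "e \<in> carrier S" "e \<otimes>\<^bsub>S\<^esub> e = e" and H: "H = units_of (local_monoid S e)"
    using assms(4) by (auto simp: maximal_subgroup_def)
  let ?Y = "{s \<in> carrier S. e \<otimes>\<^bsub>S\<^esub> s = s}"
  have H_ops: "monoid.mult H = monoid.mult S" "\<one>\<^bsub>H\<^esub> = e" "carrier H = Units (local_monoid S e)"
    by (simp_all add: H units_of_def local_monoid_def)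
  have "e \<otimes>\<^bsub>S\<^esub> e \<otimes>\<^bsub>S\<^esub> e = e" using e by simp
  then have "e \<in> carrier (local_monoid S e)" using e(1) unfolding local_monoid_def by force
  then have "e \<in> carrier H"
    unfolding H_ops Units_def using e(2) by (auto simp: local_monoid_def)
  then have eU: "e \<in> U" using assms(5) by blast
  have YU: "y \<in> U" if "y \<in> ?Y" for y
    using U_right[OF _ eU, of y] that by auto
  obtain M where "minimal_set (right_ideal ?U) M" and "simple_semigroup ?U"
    using assms(3) by (auto simp: completely_simple_def)
  then have right_mult: "\<exists>t\<in>carrier S. y \<otimes>\<^bsub>S\<^esub> t = e" if "y \<in> ?Y" for y
    using idempotent_right_multiple[of ?U M e y] that eU e YU[OF that] US U_left S.m_assoc
    by auto
  have grp: "group H" and H_car: "carrier H = {x \<in> carrier S. e \<otimes>\<^bsub>S\<^esub> x = x \<and> x \<otimes>\<^bsub>S\<^esub> e = x}"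
    using Units_local_monoid[OF assms(1) e] right_mult unfolding H H_ops(3)[unfolded H] by auto
  interpret H: group H by (fact grp)
  have mult_Y: "s \<otimes>\<^bsub>S\<^esub> y \<in> ?Y" if "s \<in> ?Y" "y \<in> ?Y" for s y
    using that e S.m_assoc[of e s y] by auto
  \<comment> \<open>The left ideal \<open>U y\<close> of \<open>U\<close> determines the orbit of \<open>y\<close> under \<open>H\<close>.\<close>
  define Uy where "Uy y = (\<lambda>u. u \<otimes>\<^bsub>S\<^esub> y) ` U" for y
  have orb: "Uy y = Uy z \<longleftrightarrow> (\<exists>h\<in>carrier H. y = h \<otimes>\<^bsub>S\<^esub> z)" if y: "y \<in> ?Y" and z: "z \<in> ?Y" for y z
  proof
    assume "Uy y = Uy z"
    moreover have "y \<in> Uy y" using y eU unfolding Uy_def by force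
    ultimately obtain u where u: "u \<in> U" "y = u \<otimes>\<^bsub>S\<^esub> z" by (auto simp: Uy_def)
    have "y = e \<otimes>\<^bsub>S\<^esub> (u \<otimes>\<^bsub>S\<^esub> (e \<otimes>\<^bsub>S\<^esub> z))" using u y z by auto
    also have "\<dots> = (e \<otimes>\<^bsub>S\<^esub> u \<otimes>\<^bsub>S\<^esub> e) \<otimes>\<^bsub>S\<^esub> z" using e(1) US[OF u(1)] z by (simp add: S.m_assoc)
    finally have "y = (e \<otimes>\<^bsub>S\<^esub> u \<otimes>\<^bsub>S\<^esub> e) \<otimes>\<^bsub>S\<^esub> z" .
    moreover have "e \<otimes>\<^bsub>S\<^esub> u \<otimes>\<^bsub>S\<^esub> e \<in> carrier H"
    proof -
      have "e \<otimes>\<^bsub>S\<^esub> (e \<otimes>\<^bsub>S\<^esub> u \<otimes>\<^bsub>S\<^esub> e) = (e \<otimes>\<^bsub>S\<^esub> e) \<otimes>\<^bsub>S\<^esub> u \<otimes>\<^bsub>S\<^esub> e"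
        using e(1) US[OF u(1)] by (simp add: S.m_assoc)
      moreover have "(e \<otimes>\<^bsub>S\<^esub> u \<otimes>\<^bsub>S\<^esub> e) \<otimes>\<^bsub>S\<^esub> e = e \<otimes>\<^bsub>S\<^esub> u \<otimes>\<^bsub>S\<^esub> (e \<otimes>\<^bsub>S\<^esub> e)"
        using e(1) US[OF u(1)] by (simp add: S.m_assoc)
      ultimately show ?thesis using e US[OF u(1)] by (simp add: H_car)
    qed
    ultimately show "\<exists>h\<in>carrier H. y = h \<otimes>\<^bsub>S\<^esub> z" by blast
  next
    have sub: "Uy (h \<otimes>\<^bsub>S\<^esub> z) \<subseteq> Uy z" if "h \<in> carrier S" "z \<in> carrier S" for h z
    proof
      fix v assume "v \<in> Uy (h \<otimes>\<^bsub>S\<^esub> z)"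
      then obtain u where "u \<in> U" "v = u \<otimes>\<^bsub>S\<^esub> (h \<otimes>\<^bsub>S\<^esub> z)" by (auto simp: Uy_def)
      then have "v = (u \<otimes>\<^bsub>S\<^esub> h) \<otimes>\<^bsub>S\<^esub> z" "u \<otimes>\<^bsub>S\<^esub> h \<in> U"
        using that US U_right by (simp_all add: S.m_assoc)
      then show "v \<in> Uy z" by (auto simp: Uy_def)
    qed
    assume "\<exists>h\<in>carrier H. y = h \<otimes>\<^bsub>S\<^esub> z"
    then obtain h where h: "h \<in> carrier H" "y = h \<otimes>\<^bsub>S\<^esub> z" by blast
    let ?g = "inv\<^bsub>H\<^esub> h"
    have g: "?g \<in> carrier H" "?g \<otimes>\<^bsub>S\<^esub> h = e"
      using H.inv_closed[OF h(1)] H.l_inv[OF h(1)] H_ops by auto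
    then have "?g \<otimes>\<^bsub>S\<^esub> y = z"
      using h z S.m_assoc[of ?g h z] by (auto simp: H_car)
    then show "Uy y = Uy z"
      using sub[of h z] sub[of ?g y] h g(1) y z by (auto simp: H_car)
  qed
  have "left_ideal ?U (Uy y)" if "y \<in> ?Y" for y
    unfolding left_ideal_def
  proof (intro conjI ballI)
    show "Uy y \<subseteq> carrier ?U" "Uy y \<noteq> {}" using that eU U_right by (auto simp: Uy_def)
    fix s x assume "s \<in> carrier ?U" "x \<in> Uy y"
    then obtain u where "s \<in> U" "u \<in> U" "x = u \<otimes>\<^bsub>S\<^esub> y" by (auto simp: Uy_def)
    then have "s \<otimes>\<^bsub>?U\<^esub> x = (s \<otimes>\<^bsub>S\<^esub> u) \<otimes>\<^bsub>S\<^esub> y" "s \<otimes>\<^bsub>S\<^esub> u \<in> U"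
      using that US U_left by (simp_all add: S.m_assoc)
    then show "s \<otimes>\<^bsub>?U\<^esub> x \<in> Uy y" by (auto simp: Uy_def)
  qed
  then have "finite (Uy ` ?Y)" by (intro finite_subset[OF _ assms(7)]) auto
  then have "\<exists>T. finite T \<and> T \<subseteq> ?Y \<and> bij_betw (\<lambda>(h, x). h \<otimes>\<^bsub>S\<^esub> x) (carrier H \<times> T) ?Y"
    using orb right_mult mult_Y
    by (intro orbit_transversal[OF assms(1) H.monoid_axioms]) (auto simp: H_car H_ops)
  then show ?thesis
    using left_FP_corner[OF assms(1,6) H.monoid_axioms _ H_ops(1)] H_ops(2) H_car by auto
qed

end
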